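(* Let $d\ge 1$ be an integer, let $(X,\mathcal{B},\mu)$ be a probability space, let $T_1,\dots,T_d$ be commuting invertible measure preserving transformations of $(X,\mathcal B,\mu)$, and let $A\in\mathcal{B}$. Then the limit of the averages $$\prod_{i=1}^d \frac{1}{N_i-M_i}\ \sum_{\substack{n_i\in[M_i, N_i)\\ i=1,\dots,d}}\mu\Big(\bigcap_{\epsilon\in\{0,1\}^d} T_1^{-n_1\epsilon_1}\cdots T_d^{-n_d\epsilon_d} A\Big)$$ exists and is greater than or equal to $\mu(A)^{2^d}$ for all sequences of intervals $[M_1,N_1),\dots,[M_d,N_d)$ whose lengths $N_i-M_i$ ($1\leq i\leq d$) tend to $\infty$.
   Context: Here $\epsilon=\epsilon_1\cdots\epsilon_d$ with $\epsilon_i\in\{0,1\}$. The intervals are intervals of integers: $[M_i,N_i)=\{n\in\mathbb Z: M_i\le n<N_i\}$ with $M_i<N_i$ integers. "For all sequences of intervals" means: for each $i=1,\dots,d$ one is given a sequence of intervals $([M_{i,k},N_{i,k}))_{k\ge 1}$ with $N_{i,k}-M_{i,k}\to\infty$ as $k\to\infty$, and the limit is taken as $k\to\infty$ of the averages over $[M_{1,k},N_{1,k})\times\cdots\times[M_{d,k},N_{d,k})$. *)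

theory Defs
  imports "HOL-Probability.Probability"
begin

definition invertible_measure_preserving :: "'a measure \<Rightarrow> ('a \<Rightarrow> 'a) \<Rightarrow> bool" where
  "invertible_measure_preserving \<mu> T \<longleftrightarrow>
     bij_betw T (space \<mu>) (space \<mu>) \<and>
     T \<in> measurable \<mu> \<mu> \<and>
     inv_into (space \<mu>) T \<in> measurable \<mu> \<mu> \<and>
     (\<forall>B\<in>sets \<mu>. emeasure \<mu> (T -` B \<inter> space \<mu>) = emeasure \<mu> B)"

definition int_iterate :: "'a measure \<Rightarrow> ('a \<Rightarrow> 'a) \<Rightarrow> int \<Rightarrow> 'a \<Rightarrow> 'a" where
  "int_iterate \<mu> T n =
     (if n \<ge> 0 then T ^^ nat n else inv_into (space \<mu>) T ^^ nat (- n))"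

text \<open>
  The set \<open>T\<^sub>1 ^ m\<^sub>1 (\<dots> (T\<^sub>d ^ m\<^sub>d A))\<close>. Integer powers of the invertible maps act on sets by
  image, so a negative power acts as the usual preimage.
\<close>

definition translate ::
    "'a measure \<Rightarrow> nat \<Rightarrow> (nat \<Rightarrow> 'a \<Rightarrow> 'a) \<Rightarrow> (nat \<Rightarrow> int) \<Rightarrow> 'a set \<Rightarrow> 'a set" where
  "translate \<mu> d T m A = foldr (\<lambda>i S. int_iterate \<mu> (T i) (m i) ` S) [1..<Suc d] A"

text \<open>The cube \<open>{0,1}\<^sup>d\<close>, with coordinates indexed by \<open>1, \<dots>, d\<close>.\<close>

definition cube :: "nat \<Rightarrow> (nat \<Rightarrow> int) set" where
  "cube d = {1..d} \<rightarrow>\<^sub>E {0, 1}"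

definition cube_average ::
    "'a measure \<Rightarrow> nat \<Rightarrow> (nat \<Rightarrow> 'a \<Rightarrow> 'a) \<Rightarrow> 'a set \<Rightarrow> (nat \<Rightarrow> int) \<Rightarrow> (nat \<Rightarrow> int) \<Rightarrow> real" where
  "cube_average \<mu> d T A M N =
     (\<Prod>i=1..d. 1 / real_of_int (N i - M i)) *
     (\<Sum>n \<in> (\<Pi>\<^sub>E i\<in>{1..d}. {M i..<N i}).
        measure \<mu> (\<Inter>\<epsilon>\<in>cube d. translate \<mu> d T (\<lambda>i. - (n i * \<epsilon> i)) A))"

end

theory Submission
  imports Defs
begin

text \<open>
  Write \<open>n\<cdot>J\<close> for the vector that agrees with \<open>n\<close> on \<open>J\<close> and vanishes elsewhere, and \<open>T\<^sup>m\<close> for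
  the action of \<open>m\<close>. The measure of the intersection over the cube is the integral of
  \<open>\<Prod>\<^bsub>J \<subseteq> {1..d}\<^esub> 1\<^sub>A \<circ> T\<^bsup>n\<cdot>J\<^esup>\<close>. The proof puts an arbitrary bounded function \<open>f\<^sub>J\<close> at each vertex
  \<open>J\<close> of the cube and shows that the averages over boxes of \<open>E (\<Prod>\<^bsub>J\<^esub> f\<^sub>J \<circ> T\<^bsup>n\<cdot>J\<^esup>)\<close> form a Cauchy
  net as all side lengths grow. The induction is on a down-closed set \<open>U\<close> of vertices outside
  of which the functions are constantly \<open>1\<close>; when \<open>U\<close> has at most the vertex \<open>{}\<close> the averages
  are constant.

  For the induction step let \<open>I\<close> be a maximal vertex of \<open>U\<close>. By invariance the average over a
  box \<open>b\<close> is \<open>E (f\<^sub>I \<psi>\<^sub>b)\<close> with \<open>\<psi>\<^sub>b\<close> built from the functions at the other vertices, so the claim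
  is that the uniformly bounded functions \<open>\<psi>\<^sub>b\<close> converge weakly. Two facts are available.

  \<^item> Applying the van der Corput inequality in the directions of \<open>I\<close>, one at a time, eliminates
    all vertices but \<open>I\<close> and bounds \<open>E (\<theta> \<psi>\<^sub>b)\<close> by the box seminorm of \<open>\<theta>\<close>
    (\<open>cube_avg_le_box_mean\<close>). Its power \<open>2 ^ card I\<close> is a mean of
    \<open>E (\<Prod>\<^bsub>J \<subseteq> I\<^esub> \<theta> \<circ> T\<^bsup>h\<cdot>J\<^esup>)\<close> over shifts \<open>h\<close>.

  \<^item> Reading this mean as an integral over pairs \<open>(x, h)\<close> gives an extension of the system, on
    which the action can be chosen so that the function \<open>\<theta>\<close> at a vertex \<open>J \<noteq> I\<close> of the cube is
    invariant in some direction \<open>i \<in> I - J\<close>. The product of these functions, placed at \<open>I\<close>, can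
    then be moved to the vertices \<open>I - {i}\<close>, which frees the vertex \<open>I\<close>: the induction
    hypothesis, applied to the extension, shows that the pairing of \<open>\<psi>\<^sub>b\<close> with the dual function
    of \<open>\<theta>\<close> converges (\<open>dual_face_avg\<close>).

  If \<open>\<psi>\<close> and \<open>\<psi>'\<close> were two weak limit points and \<open>\<theta> = \<psi> - \<psi>'\<close>, then the pairing of \<open>\<theta>\<close> with
  its own dual function, which is the power of its box seminorm, would vanish by the second fact,
  hence \<open>E (\<theta> \<theta>) = 0\<close> by the first (\<open>weak_Cauchy_criterion\<close>). That \<open>\<theta>\<close> is again bounded is what
  makes this work without any further structure theory.

  The extension need not carry a countably additive measure when the probability space is
  arbitrary. Only an algebra of bounded functions with an invariant positive functional is used,
  and on the extension this functional is a limit along an ultrafilter.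

  For the lower bound, the same van der Corput estimate with \<open>1\<^sub>A\<close> at one vertex and \<open>1\<close> at the
  others shows that the finite box mean of \<open>1\<^sub>A\<close> is at least \<open>\<mu>(A) ^ (2 ^ d)\<close>. This box mean is
  a mean of averages over boxes of one common side length, so one of those boxes has an average
  that is at least as large; by the Cauchy property so has, up to any error, every large box.
\<close>

section \<open>Averages over boxes of integers\<close>

definition avg :: "'i set \<Rightarrow> ('i \<Rightarrow> real) \<Rightarrow> real" where
  "avg S f = (\<Sum>x\<in>S. f x) / real (card S)"

lemma avg_const: "finite S \<Longrightarrow> S \<noteq> {} \<Longrightarrow> avg S (\<lambda>_. c) = c"
  by (simp add: avg_def)

lemma avg_cong: "S = R \<Longrightarrow> (\<And>x. x \<in> R \<Longrightarrow> f x = g x) \<Longrightarrow> avg S f = avg R g"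
  by (simp add: avg_def)

lemma avg_mono: "(\<And>x. x \<in> S \<Longrightarrow> f x \<le> g x) \<Longrightarrow> avg S f \<le> avg S g"
  by (simp add: avg_def divide_right_mono sum_mono)

lemma avg_add: "avg S (\<lambda>x. f x + g x) = avg S f + avg S g"
  by (simp add: avg_def sum.distrib add_divide_distrib)

lemma avg_diff: "avg S (\<lambda>x. f x - g x) = avg S f - avg S g"
  by (simp add: avg_def sum_subtractf diff_divide_distrib)

lemma avg_cmult: "avg S (\<lambda>x. c * f x) = c * avg S f"
  by (simp add: avg_def sum_distrib_left)

lemma avg_mult_right: "avg S (\<lambda>x. f x * c) = avg S f * c"
  by (simp add: avg_def sum_distrib_right)

lemma avg_swap: "avg S (\<lambda>x. avg R (f x)) = avg R (\<lambda>y. avg S (\<lambda>x. f x y))"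
  unfolding avg_def by (simp add: sum_divide_distrib[symmetric] sum.swap[of _ S R] mult.commute)

lemma abs_avg_le:
  assumes "\<And>x. x \<in> S \<Longrightarrow> \<bar>f x\<bar> \<le> C" and "0 \<le> C"
  shows "\<bar>avg S f\<bar> \<le> C"
proof -
  have "\<bar>\<Sum>x\<in>S. f x\<bar> \<le> C * card S"
    using order_trans[OF sum_abs sum_bounded_above[of S "\<lambda>x. \<bar>f x\<bar>" C]] assms(1)
    by (simp add: mult.commute)
  then show ?thesis
    using assms(2) by (cases "card S = 0") (auto simp: avg_def divide_simps)
qed

lemma power2_avg_le: "(avg S f)\<^sup>2 \<le> avg S (\<lambda>x. (f x)\<^sup>2)"
proof -
  have "(\<Sum>x\<in>S. f x)\<^sup>2 / (real (card S))\<^sup>2 \<le> (\<Sum>x\<in>S. (f x)\<^sup>2) * card S / (real (card S))\<^sup>2"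
    by (intro divide_right_mono sum_squared_le_sum_of_squares) auto
  then show ?thesis
    by (cases "card S = 0") (simp_all add: avg_def power_divide power2_eq_square)
qed

text \<open>
  Jensen's inequality for \<open>t ^ (2 ^ k)\<close>. For \<open>k = 0\<close> it is an equality, so \<open>f\<close> may take
  negative values; the induction that yields \<open>cube_avg_le_box_mean\<close> starts at that exponent.
\<close>

lemma power_avg_le: "(avg S f) ^ (2 ^ k) \<le> avg S (\<lambda>x. f x ^ (2 ^ k))"
proof (induction k arbitrary: f)
  case (Suc k)
  have "(avg S f) ^ (2 ^ Suc k) = ((avg S f)\<^sup>2) ^ (2 ^ k)"
    by (simp add: power_mult)
  also have "\<dots> \<le> (avg S (\<lambda>x. (f x)\<^sup>2)) ^ (2 ^ k)"
    by (intro power_mono power2_avg_le) auto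
  also have "\<dots> \<le> avg S (\<lambda>x. ((f x)\<^sup>2) ^ (2 ^ k))"
    by (rule Suc.IH)
  finally show ?case by (simp add: power_mult)
qed simp

definition grid :: "nat set \<Rightarrow> (nat \<Rightarrow> int) \<Rightarrow> (nat \<Rightarrow> int) \<Rightarrow> (nat \<Rightarrow> int) set" where
  "grid D M N = (\<Pi>\<^sub>E i\<in>D. {M i..<N i})"

lemma finite_grid: "finite D \<Longrightarrow> finite (grid D M N)"
  unfolding grid_def by (intro finite_PiE) auto

lemma grid_nonempty: "(\<And>i. i \<in> D \<Longrightarrow> M i < N i) \<Longrightarrow> grid D M N \<noteq> {}"
  unfolding grid_def by (auto simp: PiE_eq_empty_iff)

lemma grid_empty [simp]: "grid {} M N = {\<lambda>_. undefined}"
  by (simp add: grid_def)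

lemma avg_grid_insert:
  assumes "finite D" "i \<notin> D"
  shows "avg (grid (insert i D) M N) g = avg {M i..<N i} (\<lambda>y. avg (grid D M N) (\<lambda>n. g (n(i := y))))"
proof -
  let ?T = "\<lambda>i. {M i..<N i}"
  have inj: "inj_on (\<lambda>(y, n). n(i := y)) (?T i \<times> Pi\<^sub>E D ?T)"
    by (rule inj_combinator[OF assms(2)])
  have "(\<Sum>n\<in>Pi\<^sub>E (insert i D) ?T. g n) = (\<Sum>(y, n)\<in>?T i \<times> Pi\<^sub>E D ?T. g (n(i := y)))"
    unfolding PiE_insert_eq by (subst sum.reindex[OF inj]) (simp add: case_prod_unfold)
  also have "\<dots> = (\<Sum>y\<in>?T i. \<Sum>n\<in>Pi\<^sub>E D ?T. g (n(i := y)))"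
    by (simp add: sum.cartesian_product)
  finally have *: "(\<Sum>n\<in>Pi\<^sub>E (insert i D) ?T. g n) = (\<Sum>y\<in>?T i. \<Sum>n\<in>Pi\<^sub>E D ?T. g (n(i := y)))" .
  have "card (Pi\<^sub>E (insert i D) ?T) = card (?T i) * card (Pi\<^sub>E D ?T)"
    using assms by (simp add: card_PiE)
  then show ?thesis
    using * by (simp add: avg_def grid_def sum_divide_distrib[symmetric] mult.commute)
qed

lemma avg_shift_nat:
  fixes b :: "int \<Rightarrow> real"
  assumes "\<And>y. \<bar>b y\<bar> \<le> C" "M < N"
  shows "\<bar>avg {M..<N} (\<lambda>y. b (y + int a)) - avg {M..<N} b\<bar> \<le> 2 * C * a / (N - M)"
proof -
  have *: "\<bar>(\<Sum>y\<in>{M..<N}. b (y + int a)) - (\<Sum>y\<in>{M..<N}. b y)\<bar> \<le> 2 * C * a"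
  proof (induction a)
    case (Suc a)
    have "(\<Sum>y\<in>{M..<N}. b (y + int (Suc a))) = (\<Sum>y\<in>{M+1..<N+1}. b (y + int a))"
      by (rule sum.reindex_bij_witness[of _ "\<lambda>y. y - 1" "\<lambda>y. y + 1"]) (auto simp: algebra_simps)
    also have "{M+1..<N+1} = insert N {M+1..<N}" using assms(2) by auto
    also have "(\<Sum>y\<in>insert N {M+1..<N}. b (y + int a)) = b (N + int a) + (\<Sum>y\<in>{M+1..<N}. b (y + int a))"
      by simp
    finally have 1: "(\<Sum>y\<in>{M..<N}. b (y + int (Suc a))) = b (N + int a) + (\<Sum>y\<in>{M+1..<N}. b (y + int a))" .
    have "{M..<N} = insert M {M+1..<N}" using assms(2) by auto
    then have "(\<Sum>y\<in>{M..<N}. b (y + int a)) = b (M + int a) + (\<Sum>y\<in>{M+1..<N}. b (y + int a))"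
      by simp
    then have "\<bar>(\<Sum>y\<in>{M..<N}. b (y + int (Suc a))) - (\<Sum>y\<in>{M..<N}. b (y + int a))\<bar> \<le> 2 * C"
      using 1 assms(1)[of "N + int a"] assms(1)[of "M + int a"] by linarith
    then show ?case using Suc by (simp add: algebra_simps)
  qed simp
  have card: "real (card {M..<N}) = real_of_int (N - M)" using assms(2) by simp
  have "\<bar>avg {M..<N} (\<lambda>y. b (y + int a)) - avg {M..<N} b\<bar>
    = \<bar>(\<Sum>y\<in>{M..<N}. b (y + int a)) - (\<Sum>y\<in>{M..<N}. b y)\<bar> / (N - M)"
    unfolding avg_def card using assms(2)
    by (simp add: diff_divide_distrib[symmetric] abs_divide)
  also have "\<dots> \<le> 2 * C * a / (N - M)"
    by (rule divide_right_mono[OF *]) (use assms(2) in simp)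
  finally show ?thesis .
qed

lemma avg_shift:
  fixes b :: "int \<Rightarrow> real"
  assumes "\<And>y. \<bar>b y\<bar> \<le> C" "M < N"
  shows "\<bar>avg {M..<N} (\<lambda>y. b (y + a)) - avg {M..<N} b\<bar> \<le> 2 * C * \<bar>a\<bar> / (N - M)"
proof (cases "a \<ge> 0")
  case True
  then show ?thesis using avg_shift_nat[of b C M N "nat a"] assms by simp
next
  case False
  then show ?thesis
    using avg_shift_nat[of "\<lambda>y. b (y + a)" C M N "nat (- a)"] assms
    by (simp add: abs_minus_commute)
qed

lemma avg_le_some:
  assumes "finite S" "S \<noteq> {}"
  obtains x where "x \<in> S" "avg S f \<le> f x"
proof -
  have "\<exists>x\<in>S. avg S f \<le> f x"
  proof (rule ccontr)
    assume "\<not> (\<exists>x\<in>S. avg S f \<le> f x)"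
    then have "(\<Sum>x\<in>S. f x) < (\<Sum>x\<in>S. avg S f)"
      using assms by (intro sum_strict_mono) auto
    then show False using assms by (simp add: avg_def)
  qed
  then show thesis using that by blast
qed

section \<open>Generalized limits of bounded sequences\<close>

lemma ultrafilter_exists:
  "\<exists>U. U \<le> sequentially \<and> U \<noteq> bot \<and> (\<forall>P. eventually P U \<or> eventually (\<lambda>x. \<not> P x) U)"
proof -
  let ?A = "{F :: nat filter. F \<le> sequentially \<and> F \<noteq> bot}"
  let ?P = "\<lambda>F G :: nat filter. G \<le> F"
  have po: "partial_order_on ?A (relation_of ?P ?A)"
    by (rule partial_order_on_relation_ofI) auto
  have ch: "\<exists>u\<in>?A. \<forall>a\<in>C. u \<le> a" if C: "C \<in> Chains (relation_of ?P ?A)" for C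
  proof (cases "C = {}")
    case True
    then show ?thesis by (intro bexI[of _ sequentially]) auto
  next
    case False
    have sub: "C \<subseteq> ?A" and lin: "\<And>F G. F \<in> C \<Longrightarrow> G \<in> C \<Longrightarrow> F \<le> G \<or> G \<le> F"
      using C unfolding Chains_def relation_of_def by auto
    have base: "\<exists>x\<in>C. x \<le> F \<and> x \<le> G" if "F \<in> C" "G \<in> C" for F G
      using lin[OF that] that by auto
    have "eventually P (Inf C) \<longleftrightarrow> (\<exists>b\<in>C. eventually P b)" for P
      by (rule eventually_Inf_base[OF False]) (use base in auto)
    then have "Inf C \<noteq> bot"
      using sub by (auto simp: trivial_limit_def)
    moreover have "Inf C \<le> sequentially"
      proof -
      obtain F where "F \<in> C" using False by auto
      then show ?thesis using sub by (auto intro: Inf_lower2)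
    qed
    ultimately show ?thesis by (intro bexI[of _ "Inf C"]) (auto intro: Inf_lower)
  qed
  obtain U where U: "U \<in> ?A" and min: "\<And>F. F \<in> ?A \<Longrightarrow> F \<le> U \<Longrightarrow> F = U"
    using predicate_Zorn[OF po ch] by auto
  have "eventually P U \<or> eventually (\<lambda>x. \<not> P x) U" for P
  proof (rule disjCI)
    assume "\<not> eventually (\<lambda>x. \<not> P x) U"
    then have "inf U (principal {x. P x}) \<noteq> bot"
      by (auto simp: trivial_limit_def eventually_inf_principal)
    moreover have "inf U (principal {x. P x}) \<le> sequentially"
      using U by (auto intro: le_infI1)
    ultimately have "inf U (principal {x. P x}) = U" by (intro min) auto
    then have "U \<le> principal {x. P x}" by (metis inf_le2)
    then show "eventually P U" by (auto simp: le_principal)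
  qed
  then show ?thesis using U by auto
qed

definition ultra :: "nat filter" where
  "ultra = (SOME U. U \<le> sequentially \<and> U \<noteq> bot \<and> (\<forall>P. eventually P U \<or> eventually (\<lambda>x. \<not> P x) U))"

lemma ultra: "ultra \<le> sequentially" "ultra \<noteq> bot"
    "eventually P ultra \<or> eventually (\<lambda>x. \<not> P x) ultra"
  using someI_ex[OF ultrafilter_exists, folded ultra_def] by auto

text \<open>
  A positive linear functional on all bounded sequences that extends the limit. On the extensions
  of a system the means along growing boxes have no reason to converge for every function of the
  algebra, so an honest limit would not do.
\<close>

definition ulim :: "(nat \<Rightarrow> real) \<Rightarrow> real" where
  "ulim a = Lim ultra a"

lemma tendsto_ulim:
  fixes a :: "nat \<Rightarrow> real"
  assumes "\<And>n. \<bar>a n\<bar> \<le> C"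
  shows "(a \<longlongrightarrow> ulim a) ultra"
proof -
  have "filtermap a ultra \<noteq> bot" using ultra(2) by (simp add: filtermap_bot_iff)
  moreover have "eventually (\<lambda>x. x \<in> {-C..C}) (filtermap a ultra)"
    using assms by (auto simp: eventually_filtermap abs_le_iff minus_le_iff intro!: always_eventually)
  ultimately obtain x where x: "inf (nhds x) (filtermap a ultra) \<noteq> bot"
    using compact_filter[of "{-C..C}"] by auto
  have "(a \<longlongrightarrow> x) ultra"
    unfolding tendsto_def
  proof (intro allI impI)
    fix S assume "open S" "x \<in> S"
    then have "eventually (\<lambda>y. y \<in> S) (nhds x)" by (simp add: eventually_nhds_in_open)
    moreover have "\<not> eventually (\<lambda>y. y \<notin> S) (filtermap a ultra)"
    proof
      assume "eventually (\<lambda>y. y \<notin> S) (filtermap a ultra)"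
      with \<open>eventually (\<lambda>y. y \<in> S) (nhds x)\<close>
      have "eventually (\<lambda>_. False) (inf (nhds x) (filtermap a ultra))"
        unfolding eventually_inf by blast
      then show False using x by (simp add: trivial_limit_def)
    qed
    ultimately show "eventually (\<lambda>n. a n \<in> S) ultra"
      using ultra(3)[of "\<lambda>n. a n \<in> S"] by (simp add: eventually_filtermap)
  qed
  then show ?thesis unfolding ulim_def using tendsto_Lim[OF ultra(2)] by metis
qed

lemma ulim_unique: "(a \<longlongrightarrow> L) ultra \<Longrightarrow> ulim a = L"
  unfolding ulim_def using tendsto_Lim[OF ultra(2)] by metis

lemma ulim_eq: "a \<longlonglongrightarrow> L \<Longrightarrow> ulim a = L"
  by (rule ulim_unique[OF tendsto_mono[OF ultra(1)]])

lemma ulim_add: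
  assumes "\<And>n. \<bar>a n\<bar> \<le> C" "\<And>n. \<bar>b n\<bar> \<le> C'"
  shows "ulim (\<lambda>n. a n + b n) = ulim a + ulim b"
  by (rule ulim_unique[OF tendsto_add[OF tendsto_ulim[OF assms(1)] tendsto_ulim[OF assms(2)]]])

lemma ulim_cmult:
  assumes "\<And>n. \<bar>a n\<bar> \<le> C"
  shows "ulim (\<lambda>n. c * a n) = c * ulim a"
  by (rule ulim_unique[OF tendsto_mult_left[OF tendsto_ulim[OF assms]]])

lemma ulim_ge:
  assumes "\<And>n. \<bar>a n\<bar> \<le> C" "\<And>n. n > 0 \<Longrightarrow> c \<le> a n"
  shows "c \<le> ulim a"
proof (rule tendsto_lowerbound[OF tendsto_ulim[OF assms(1)] _ ultra(2)])
  have "eventually (\<lambda>n. c \<le> a n) sequentially"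
    using eventually_gt_at_top[of "0::nat"] by eventually_elim (rule assms(2))
  then show "eventually (\<lambda>n. c \<le> a n) ultra"
    by (rule filter_leD[OF ultra(1)])
qed

section \<open>Actions with an invariant mean and the van der Corput inequality\<close>

text \<open>
  If \<open>\<epsilon>\<close> is the indicator of \<open>J\<close>, this is the vector \<open>(n\<^sub>i \<epsilon>\<^sub>i)\<^sub>i\<close>. Vertices of the cube
  are represented by the sets \<open>J\<close>.
\<close>

definition mask :: "nat set \<Rightarrow> (nat \<Rightarrow> int) \<Rightarrow> nat \<Rightarrow> int" where
  "mask J n = (\<lambda>j. if j \<in> J then n j else 0)"

definition along :: "nat \<Rightarrow> int \<Rightarrow> nat \<Rightarrow> int" where
  "along i k = (\<lambda>j. if j = i then k else 0)"

lemma mask_empty [simp]: "mask {} n = (\<lambda>_. 0)"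
  by (simp add: mask_def)

lemma mask_insert_upd: "i \<notin> J \<Longrightarrow> mask (insert i J) (n(i := y)) = (\<lambda>j. mask J n j + along i y j)"
  by (auto simp: mask_def along_def)

lemma mask_upd: "i \<notin> J \<Longrightarrow> mask J (n(i := y)) = mask J n"
  by (auto simp: mask_def)

lemma along_add: "along i (k + l) = (\<lambda>j. along i k j + along i l j)"
  by (auto simp: along_def)

lemma prod_Pow_insert:
  assumes "finite I" "i \<notin> I"
  shows "(\<Prod>J\<in>Pow (insert i I). g J) = (\<Prod>J\<in>Pow I. g J * g (insert i J))"
proof -
  have inj: "inj_on (insert i) (Pow I)"
    using assms(2) by (auto simp: inj_on_def)
  have disj: "Pow I \<inter> insert i ` Pow I = {}"
    using assms(2) by auto
  have "(\<Prod>J\<in>Pow (insert i I). g J) = (\<Prod>J\<in>Pow I. g J) * (\<Prod>J\<in>insert i ` Pow I. g J)"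
    unfolding Pow_insert by (rule prod.union_disjoint) (use assms disj in auto)
  also have "(\<Prod>J\<in>insert i ` Pow I. g J) = (\<Prod>J\<in>Pow I. g (insert i J))"
    by (rule prod.reindex_cong[OF inj]) auto
  finally show ?thesis by (simp add: prod.distrib)
qed

lemma abs_prod_le_1:
  fixes g :: "'i \<Rightarrow> real"
  assumes "\<And>i. i \<in> S \<Longrightarrow> \<bar>g i\<bar> \<le> 1"
  shows "\<bar>\<Prod>i\<in>S. g i\<bar> \<le> 1"
  unfolding abs_prod by (rule prod_le_1) (use assms in auto)

lemma avg_grid_translate:
  "avg (grid D (\<lambda>i. - m i) (\<lambda>i. H - m i)) (\<lambda>k. g (mask D k))
    = avg (grid D (\<lambda>_. 0) (\<lambda>_. H)) (\<lambda>n. g (mask D (\<lambda>i. n i - m i)))"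
proof -
  let ?S = "grid D (\<lambda>_. 0) (\<lambda>_. H)" and ?T = "grid D (\<lambda>i. - m i) (\<lambda>i. H - m i)"
  let ?h = "\<lambda>n. \<lambda>i\<in>D. n i - m i" and ?h' = "\<lambda>n. \<lambda>i\<in>D. n i + m i"
  have bij: "bij_betw ?h ?S ?T"
  proof (rule bij_betw_byWitness[of _ ?h'])
    show "\<forall>n\<in>?S. ?h' (?h n) = n" "\<forall>n\<in>?T. ?h (?h' n) = n"
      unfolding grid_def by (auto simp: fun_eq_iff PiE_def extensional_def)
    show "?h ` ?S \<subseteq> ?T" "?h' ` ?T \<subseteq> ?S"
      unfolding grid_def by (force simp: PiE_def Pi_def)+
  qed
  have "mask D (?h n) = mask D (\<lambda>i. n i - m i)" for n
    by (auto simp: mask_def fun_eq_iff)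
  then show ?thesis
    using sum.reindex_bij_betw[OF bij, of "\<lambda>k. g (mask D k)"] bij_betw_same_card[OF bij]
    by (simp add: avg_def)
qed

text \<open>
  A finitely additive dynamical system: \<open>A\<close> is an algebra of bounded functions on the type \<open>'c\<close>,
  \<open>E\<close> a normalized positive functional, and the group of integer vectors acts and preserves both.
  The axioms stop at finite additivity because the extension defined below preserves that much and
  not countable additivity.
\<close>

locale zsystem =
  fixes A :: "('c \<Rightarrow> real) set" and E :: "('c \<Rightarrow> real) \<Rightarrow> real"
    and act :: "(nat \<Rightarrow> int) \<Rightarrow> 'c \<Rightarrow> 'c"
  assumes const: "(\<lambda>_. c) \<in> A"
    and add: "f \<in> A \<Longrightarrow> g \<in> A \<Longrightarrow> (\<lambda>x. f x + g x) \<in> A"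
    and mult: "f \<in> A \<Longrightarrow> g \<in> A \<Longrightarrow> (\<lambda>x. f x * g x) \<in> A"
    and bounded: "f \<in> A \<Longrightarrow> \<exists>C. \<forall>x. \<bar>f x\<bar> \<le> C"
    and act_in: "f \<in> A \<Longrightarrow> (\<lambda>x. f (act n x)) \<in> A"
    and E_add: "f \<in> A \<Longrightarrow> g \<in> A \<Longrightarrow> E (\<lambda>x. f x + g x) = E f + E g"
    and E_cmult: "f \<in> A \<Longrightarrow> E (\<lambda>x. c * f x) = c * E f"
    and E_nonneg: "f \<in> A \<Longrightarrow> (\<And>x. 0 \<le> f x) \<Longrightarrow> 0 \<le> E f"
    and E_one: "E (\<lambda>_. 1) = 1"
    and E_act: "f \<in> A \<Longrightarrow> E (\<lambda>x. f (act n x)) = E f"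
    and act_act: "act m (act n x) = act (\<lambda>i. m i + n i) x"
    and act_zero: "act (\<lambda>_. 0) x = x"
begin

lemma cmult: "f \<in> A \<Longrightarrow> (\<lambda>x. c * f x) \<in> A"
  using mult[OF const] .

lemma diff: "f \<in> A \<Longrightarrow> g \<in> A \<Longrightarrow> (\<lambda>x. f x - g x) \<in> A"
  using add[of f "\<lambda>x. (-1) * g x"] cmult[of g "-1"] by simp

lemma power2: "f \<in> A \<Longrightarrow> (\<lambda>x. (f x)\<^sup>2) \<in> A"
  using mult[of f f] by (simp add: power2_eq_square)

lemma sum_in: "(\<And>i. i \<in> S \<Longrightarrow> f i \<in> A) \<Longrightarrow> (\<lambda>x. \<Sum>i\<in>S. f i x) \<in> A"
  by (induction S rule: infinite_finite_induct) (auto intro: const add)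

lemma prod_in: "(\<And>i. i \<in> S \<Longrightarrow> f i \<in> A) \<Longrightarrow> (\<lambda>x. \<Prod>i\<in>S. f i x) \<in> A"
  by (induction S rule: infinite_finite_induct) (auto intro: const mult)

lemma avg_in: "(\<And>i. i \<in> S \<Longrightarrow> f i \<in> A) \<Longrightarrow> (\<lambda>x. avg S (\<lambda>i. f i x)) \<in> A"
  using cmult[OF sum_in[of S f], of "1 / real (card S)"] by (simp add: avg_def)

lemma E_diff: "f \<in> A \<Longrightarrow> g \<in> A \<Longrightarrow> E (\<lambda>x. f x - g x) = E f - E g"
  using E_add[of f "\<lambda>x. (-1) * g x"] cmult[of g "-1"] E_cmult[of g "-1"] by simp

lemma E_const: "E (\<lambda>_. c) = c"
  using E_cmult[OF const[of 1], of c] E_one by simp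

lemma E_sum: "(\<And>i. i \<in> S \<Longrightarrow> f i \<in> A) \<Longrightarrow> E (\<lambda>x. \<Sum>i\<in>S. f i x) = (\<Sum>i\<in>S. E (f i))"
  by (induction S rule: infinite_finite_induct) (simp_all add: E_const E_add sum_in)

lemma E_avg: "(\<And>i. i \<in> S \<Longrightarrow> f i \<in> A) \<Longrightarrow> E (\<lambda>x. avg S (\<lambda>i. f i x)) = avg S (\<lambda>i. E (f i))"
  using E_cmult[OF sum_in[of S f], of "1 / real (card S)"] by (simp add: avg_def E_sum)

lemma E_mono: "f \<in> A \<Longrightarrow> g \<in> A \<Longrightarrow> (\<And>x. f x \<le> g x) \<Longrightarrow> E f \<le> E g"
  using E_nonneg[OF diff[of g f]] by (simp add: E_diff)

lemma abs_E_le: "f \<in> A \<Longrightarrow> (\<And>x. \<bar>f x\<bar> \<le> C) \<Longrightarrow> \<bar>E f\<bar> \<le> C"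
  using E_mono[of f "\<lambda>_. C"] E_mono[of "\<lambda>_. - C" f]
  by (simp add: const E_const abs_le_iff minus_le_iff)

lemma Cauchy_Schwarz:
  assumes f: "f \<in> A" and g: "g \<in> A"
  shows "(E (\<lambda>x. f x * g x))\<^sup>2 \<le> E (\<lambda>x. (f x)\<^sup>2) * E (\<lambda>x. (g x)\<^sup>2)"
proof -
  let ?a = "E (\<lambda>x. (f x)\<^sup>2)" and ?b = "E (\<lambda>x. (g x)\<^sup>2)" and ?c = "E (\<lambda>x. f x * g x)"
  have quad: "0 \<le> s\<^sup>2 * ?a - 2 * s * t * ?c + t\<^sup>2 * ?b" for s t
  proof -
    have "0 \<le> E (\<lambda>x. (s * f x - t * g x)\<^sup>2)"
      by (intro E_nonneg power2 diff cmult f g) auto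
    also have "(\<lambda>x. (s * f x - t * g x)\<^sup>2)
        = (\<lambda>x. (s\<^sup>2 * (f x)\<^sup>2 - (2 * s * t) * (f x * g x)) + t\<^sup>2 * (g x)\<^sup>2)"
      by (auto simp: power2_eq_square algebra_simps)
    also have "E \<dots> = (s\<^sup>2 * ?a - (2 * s * t) * ?c) + t\<^sup>2 * ?b"
      by (simp only: E_add E_diff E_cmult diff cmult power2 mult f g)
    finally show ?thesis by simp
  qed
  have nonneg: "0 \<le> ?a" "0 \<le> ?b" by (intro E_nonneg power2 f g; simp)+
  show ?thesis
  proof (cases "?b = 0")
    case True
    have "?c = 0"
    proof (rule ccontr)
      assume "?c \<noteq> 0"
      then show False
        using quad[of 1 "(?a + 1) / (2 * ?c)"] True by (simp add: field_simps)
    qed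
    then show ?thesis using True by simp
  next
    case False
    then have pos: "0 < ?b" using nonneg by simp
    have "0 \<le> ?b * (?a * ?b - ?c\<^sup>2)"
      using quad[of ?b ?c] by (simp add: power2_eq_square algebra_simps)
    then have "0 \<le> ?a * ?b - ?c\<^sup>2"
      using pos by (simp add: zero_le_mult_iff)
    then show ?thesis by simp
  qed
qed

lemma power2_E_le: "f \<in> A \<Longrightarrow> (E f)\<^sup>2 \<le> E (\<lambda>x. (f x)\<^sup>2)"
  using Cauchy_Schwarz[OF _ const[of 1]] by (simp add: E_one)

text \<open>
  The averages of the theorem, with a separate function at each vertex. This generality is forced
  by the induction: van der Corput's inequality changes the functions vertex by vertex.
\<close>

definition cube_avg :: "nat set \<Rightarrow> (nat set \<Rightarrow> 'c \<Rightarrow> real) \<Rightarrow> (nat \<Rightarrow> int) \<Rightarrow> (nat \<Rightarrow> int) \<Rightarrow> real" where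
  "cube_avg D f M N = avg (grid D M N) (\<lambda>n. E (\<lambda>x. \<Prod>J\<in>Pow D. f J (act (mask J n) x)))"

text \<open>
  For \<open>H \<rightarrow> \<infinity>\<close> this is the power \<open>2 ^ card I\<close> of the box seminorm of \<open>u\<close>. The shifts are differences
  \<open>n - m\<close> of two points of the same box because van der Corput's inequality produces them in
  this form; it also makes the mean nonnegative for nonempty \<open>I\<close>, being an average of terms
  \<open>E (Y\<^sup>2)\<close>.
\<close>

definition box_mean :: "nat set \<Rightarrow> nat \<Rightarrow> ('c \<Rightarrow> real) \<Rightarrow> real" where
  "box_mean I H u = avg (grid I (\<lambda>_. 0) (\<lambda>_. int H)) (\<lambda>m. avg (grid I (\<lambda>_. 0) (\<lambda>_. int H))
     (\<lambda>n. E (\<lambda>x. \<Prod>J\<in>Pow I. u (act (mask J (\<lambda>i. n i - m i)) x))))"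

text \<open>
  The box mean in one more direction is a box mean of the products that van der Corput's
  inequality produces in that direction; this is the recursion behind \<open>cube_avg_le_box_mean\<close>.
\<close>

lemma box_mean_insert:
  assumes "finite I" "i \<notin> I" and u: "u \<in> A"
  shows "box_mean (insert i I) H u = avg {0..<int H} (\<lambda>a. avg {0..<int H} (\<lambda>b.
     box_mean I H (\<lambda>x. u (act (along i a) x) * u (act (along i b) x))))"
proof -
  let ?B = "grid I (\<lambda>_. 0) (\<lambda>_. int H)" and ?R = "{0..<int H}"
  have *: "E (\<lambda>x. \<Prod>J\<in>Pow (insert i I). u (act (mask J (\<lambda>j. (n(i := b)) j - (m(i := a)) j)) x))
     = E (\<lambda>x. \<Prod>J\<in>Pow I. u (act (along i a) (act (mask J (\<lambda>j. n j - m j)) x))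
                      * u (act (along i b) (act (mask J (\<lambda>j. n j - m j)) x)))" for a b m n
  proof -
    define k where "k = (\<lambda>j. n j - m j)"
    have upd: "(\<lambda>j. (n(i := b)) j - (m(i := a)) j) = k(i := b - a)"
      by (auto simp: k_def)
    let ?F = "\<lambda>x. \<Prod>J\<in>Pow I. u (act (mask J k) x) * u (act (\<lambda>j. mask J k j + along i (b - a) j) x)"
    have FA: "?F \<in> A" by (intro prod_in mult act_in u)
    have "E (\<lambda>x. \<Prod>J\<in>Pow (insert i I). u (act (mask J (k(i := b - a))) x)) = E ?F"
      unfolding prod_Pow_insert[OF assms(1,2)]
      using assms(2) by (intro arg_cong[of _ _ E] ext prod.cong)
        (auto simp: mask_insert_upd mask_upd subset_eq)
    also have "\<dots> = E (\<lambda>x. ?F (act (along i a) x))"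
      by (rule E_act[OF FA, symmetric])
    also have "\<dots> = E (\<lambda>x. \<Prod>J\<in>Pow I. u (act (along i a) (act (mask J k) x))
                      * u (act (along i b) (act (mask J k) x)))"
    proof -
      have "(\<lambda>j. (mask J k j + along i (b - a) j) + along i a j) = (\<lambda>j. along i b j + mask J k j)" for J
        by (auto simp: along_def)
      then show ?thesis by (simp add: act_act add.commute)
    qed
    finally show ?thesis unfolding upd k_def .
  qed
  have "box_mean (insert i I) H u = avg ?R (\<lambda>a. avg ?B (\<lambda>m. avg ?R (\<lambda>b. avg ?B (\<lambda>n.
      E (\<lambda>x. \<Prod>J\<in>Pow I. u (act (along i a) (act (mask J (\<lambda>j. n j - m j)) x))
                      * u (act (along i b) (act (mask J (\<lambda>j. n j - m j)) x))))))) "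
    unfolding box_mean_def avg_grid_insert[OF assms(1,2)] * ..
  also have "\<dots> = avg ?R (\<lambda>a. avg ?R (\<lambda>b. avg ?B (\<lambda>m. avg ?B (\<lambda>n.
      E (\<lambda>x. \<Prod>J\<in>Pow I. u (act (along i a) (act (mask J (\<lambda>j. n j - m j)) x))
                      * u (act (along i b) (act (mask J (\<lambda>j. n j - m j)) x)))))))"
    by (subst avg_swap) rule
  finally show ?thesis unfolding box_mean_def .
qed

lemma box_mean_empty: "box_mean {} H u = E u"
  by (simp add: box_mean_def avg_const act_zero)

lemma abs_cube_avg_le:
  assumes "\<And>J. J \<subseteq> D \<Longrightarrow> f J \<in> A" "\<And>J x. J \<subseteq> D \<Longrightarrow> \<bar>f J x\<bar> \<le> 1"
  shows "\<bar>cube_avg D f M N\<bar> \<le> 1"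
  unfolding cube_avg_def
  by (intro abs_avg_le abs_E_le abs_prod_le_1 prod_in act_in) (use assms in auto)

lemma power2_E_mult_le:
  assumes F: "F \<in> A" and Y: "Y \<in> A" and le: "\<And>x. \<bar>F x\<bar> \<le> 1"
  shows "(E (\<lambda>x. F x * Y x))\<^sup>2 \<le> E (\<lambda>x. (Y x)\<^sup>2)"
proof -
  have "(E (\<lambda>x. F x * Y x))\<^sup>2 \<le> E (\<lambda>x. (F x * Y x)\<^sup>2)"
    by (intro power2_E_le mult F Y)
  also have "\<dots> \<le> E (\<lambda>x. (Y x)\<^sup>2)"
  proof (intro E_mono power2 mult F Y)
    fix x
    have "(F x)\<^sup>2 \<le> 1" using le[of x] by (simp add: abs_square_le_1)
    then show "(F x * Y x)\<^sup>2 \<le> (Y x)\<^sup>2"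
      by (simp add: power_mult_distrib mult_left_le_one_le)
  qed
  finally show ?thesis .
qed

text \<open>
  The average \<open>Y\<close> of \<open>G\<close> along a long interval changes little when it is averaged once more over
  \<open>H\<close> consecutive shifts. Exchanging the two averages and using the Cauchy-Schwarz inequality and
  the invariance of \<open>E\<close> in the long one leaves the square of the short average, which expands
  into the correlations on the right.
\<close>

lemma van_der_Corput_direction:
  assumes G: "G \<in> A" and le: "\<And>x. \<bar>G x\<bar> \<le> 1" and "M < N" "0 < H"
  shows "E (\<lambda>x. (avg {M..<N} (\<lambda>y. G (act (along i y) x)))\<^sup>2)
    \<le> avg {0..<int H} (\<lambda>a. avg {0..<int H} (\<lambda>b. E (\<lambda>x. G (act (along i a) x) * G (act (along i b) x))))
      + 4 * real H / real_of_int (N - M)"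
proof -
  define Y where "Y = (\<lambda>x. avg {M..<N} (\<lambda>y. G (act (along i y) x)))"
  define W where "W = (\<lambda>x. avg {0..<int H} (\<lambda>a. G (act (along i a) x)))"
  define Z where "Z = (\<lambda>x. avg {M..<N} (\<lambda>y. W (act (along i y) x)))"
  have YA: "Y \<in> A" unfolding Y_def by (intro avg_in act_in G)
  have WA: "W \<in> A" unfolding W_def by (intro avg_in act_in G)
  have ZA: "Z \<in> A" unfolding Z_def by (intro avg_in act_in WA)
  have Y1: "\<bar>Y x\<bar> \<le> 1" for x unfolding Y_def by (intro abs_avg_le le) auto
  have W1: "\<bar>W x\<bar> \<le> 1" for x unfolding W_def by (intro abs_avg_le le) auto
  have Z1: "\<bar>Z x\<bar> \<le> 1" for x unfolding Z_def by (intro abs_avg_le W1) auto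
  have YZ: "\<bar>Z x - Y x\<bar> \<le> 2 * real H / real_of_int (N - M)" for x
  proof -
    have "Z x = avg {0..<int H} (\<lambda>a. avg {M..<N} (\<lambda>y. G (act (along i (y + a)) x)))"
      unfolding Z_def W_def act_act along_add[symmetric] by (subst avg_swap) (simp add: add.commute)
    moreover have "Y x = avg {0..<int H} (\<lambda>a. Y x)"
      using \<open>0 < H\<close> by (subst avg_const) auto
    ultimately have "Z x - Y x
        = avg {0..<int H} (\<lambda>a. avg {M..<N} (\<lambda>y. G (act (along i (y + a)) x)) - Y x)"
      by (simp add: avg_diff)
    moreover have "\<bar>\<dots>\<bar> \<le> 2 * real H / real_of_int (N - M)"
    proof (rule abs_avg_le)
      fix a assume a: "a \<in> {0..<int H}"
      have "\<bar>avg {M..<N} (\<lambda>y. G (act (along i (y + a)) x)) - Y x\<bar> \<le> 2 * 1 * real_of_int \<bar>a\<bar> / (N - M)"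
        unfolding Y_def by (rule avg_shift) (use le \<open>M < N\<close> in auto)
      also have "\<dots> \<le> 2 * real H / real_of_int (N - M)"
        using a \<open>M < N\<close> by (intro divide_right_mono) auto
      finally show "\<bar>avg {M..<N} (\<lambda>y. G (act (along i (y + a)) x)) - Y x\<bar> \<le> 2 * real H / real_of_int (N - M)" .
    qed (use \<open>M < N\<close> in auto)
    ultimately show ?thesis by simp
  qed
  have "E (\<lambda>x. (Y x)\<^sup>2) \<le> E (\<lambda>x. (Z x)\<^sup>2 + 4 * real H / real_of_int (N - M))"
  proof (intro E_mono power2 YA ZA add const)
    fix x
    have "(Y x)\<^sup>2 - (Z x)\<^sup>2 = (Y x - Z x) * (Y x + Z x)" by (simp add: power2_eq_square algebra_simps)
    also have "\<dots> \<le> \<bar>Z x - Y x\<bar> * \<bar>Y x + Z x\<bar>"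
      by (metis abs_ge_self abs_minus_commute abs_mult)
    also have "\<dots> \<le> (2 * real H / real_of_int (N - M)) * 2"
      by (intro mult_mono YZ) (use Y1[of x] Z1[of x] \<open>M < N\<close> in auto)
    finally show "(Y x)\<^sup>2 \<le> (Z x)\<^sup>2 + 4 * real H / real_of_int (N - M)" by simp
  qed
  also have "\<dots> = E (\<lambda>x. (Z x)\<^sup>2) + 4 * real H / real_of_int (N - M)"
    by (simp add: E_add power2 ZA const E_const)
  also have "E (\<lambda>x. (Z x)\<^sup>2) \<le> E (\<lambda>x. (W x)\<^sup>2)"
  proof -
    have W2: "(\<lambda>x. (W x)\<^sup>2) \<in> A" by (intro power2 WA)
    have "E (\<lambda>x. (Z x)\<^sup>2) \<le> E (\<lambda>x. avg {M..<N} (\<lambda>y. (W (act (along i y) x))\<^sup>2))"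
      unfolding Z_def by (intro E_mono power2 avg_in act_in WA power2_avg_le)
    also have "\<dots> = avg {M..<N} (\<lambda>y. E (\<lambda>x. (W (act (along i y) x))\<^sup>2))"
      by (intro E_avg power2 act_in WA)
    also have "\<dots> = E (\<lambda>x. (W x)\<^sup>2)"
      using \<open>M < N\<close> by (simp add: E_act[OF W2] avg_const)
    finally show ?thesis .
  qed
  also have "(\<lambda>x. (W x)\<^sup>2) = (\<lambda>x. avg {0..<int H} (\<lambda>a. avg {0..<int H} (\<lambda>b.
      G (act (along i a) x) * G (act (along i b) x))))"
    unfolding W_def power2_eq_square by (simp add: avg_mult_right avg_cmult)
  also have "E \<dots> = avg {0..<int H} (\<lambda>a. avg {0..<int H} (\<lambda>b.
      E (\<lambda>x. G (act (along i a) x) * G (act (along i b) x))))"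
    by (simp add: E_avg avg_in mult act_in G)
  finally show ?thesis unfolding Y_def by simp
qed

text \<open>
  Split the cube in direction \<open>i\<close>. The vertices without \<open>i\<close> form a factor that does not depend
  on \<open>n\<^sub>i\<close> and is bounded by \<open>1\<close>, so the Cauchy-Schwarz inequality removes it; the average over
  \<open>n\<^sub>i\<close> of the other factor is estimated by the previous lemma. A cube of one dimension less
  remains, with products of shifts of the functions on the removed face.
\<close>

lemma van_der_Corput_cube:
  assumes D: "finite D" "i \<notin> D" and f: "\<And>J. J \<subseteq> insert i D \<Longrightarrow> f J \<in> A"
    and le: "\<And>J x. J \<subseteq> insert i D \<Longrightarrow> \<bar>f J x\<bar> \<le> 1"
    and MN: "\<And>j. j \<in> insert i D \<Longrightarrow> M j < N j" and H: "0 < H"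
  shows "(cube_avg (insert i D) f M N)\<^sup>2 \<le> avg {0..<int H} (\<lambda>a. avg {0..<int H} (\<lambda>b.
     cube_avg D (\<lambda>J x. f (insert i J) (act (along i a) x) * f (insert i J) (act (along i b) x)) M N))
     + 4 * real H / real_of_int (N i - M i)"
proof -
  define F where "F = (\<lambda>n x. \<Prod>J\<in>Pow D. f J (act (mask J n) x))"
  define G where "G = (\<lambda>n x. \<Prod>J\<in>Pow D. f (insert i J) (act (mask J n) x))"
  let ?B = "grid D M N" and ?R = "{M i..<N i}" and ?H = "{0..<int H}"
  have FA: "F n \<in> A" and GA: "G n \<in> A" for n
    unfolding F_def G_def by (intro prod_in act_in f; auto)+
  have F1: "\<bar>F n x\<bar> \<le> 1" and G1: "\<bar>G n x\<bar> \<le> 1" for n x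
    unfolding F_def G_def by (intro abs_prod_le_1 le; auto)+
  have split: "(\<Prod>J\<in>Pow (insert i D). f J (act (mask J (n(i := y))) x)) = F n x * G n (act (along i y) x)" for n y x
    unfolding prod_Pow_insert[OF D] F_def G_def prod.distrib[symmetric] using D(2)
    by (intro prod.cong) (auto simp: mask_insert_upd mask_upd act_act subset_eq)
  have "cube_avg (insert i D) f M N = avg ?R (\<lambda>y. avg ?B (\<lambda>n. E (\<lambda>x. F n x * G n (act (along i y) x))))"
    unfolding cube_avg_def avg_grid_insert[OF D] split ..
  also have "\<dots> = avg ?B (\<lambda>n. E (\<lambda>x. F n x * avg ?R (\<lambda>y. G n (act (along i y) x))))"
    by (subst avg_swap) (simp add: E_avg mult act_in FA GA flip: avg_cmult)
  finally have eq: "cube_avg (insert i D) f M N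
      = avg ?B (\<lambda>n. E (\<lambda>x. F n x * avg ?R (\<lambda>y. G n (act (along i y) x))))" .
  have "(cube_avg (insert i D) f M N)\<^sup>2
      \<le> avg ?B (\<lambda>n. (E (\<lambda>x. F n x * avg ?R (\<lambda>y. G n (act (along i y) x))))\<^sup>2)"
    unfolding eq by (rule power2_avg_le)
  also have "\<dots> \<le> avg ?B (\<lambda>n. E (\<lambda>x. (avg ?R (\<lambda>y. G n (act (along i y) x)))\<^sup>2))"
    by (intro avg_mono power2_E_mult_le FA F1 avg_in act_in GA)
  also have "\<dots> \<le> avg ?B (\<lambda>n. avg ?H (\<lambda>a. avg ?H (\<lambda>b. E (\<lambda>x. G n (act (along i a) x) * G n (act (along i b) x))))
      + 4 * real H / real_of_int (N i - M i))"
    by (intro avg_mono van_der_Corput_direction GA G1 H MN) auto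
  also have "\<dots> = avg ?B (\<lambda>n. avg ?H (\<lambda>a. avg ?H (\<lambda>b. E (\<lambda>x. G n (act (along i a) x) * G n (act (along i b) x)))))
      + 4 * real H / real_of_int (N i - M i)"
    using D MN by (simp add: avg_add avg_const finite_grid grid_nonempty)
  also have "avg ?B (\<lambda>n. avg ?H (\<lambda>a. avg ?H (\<lambda>b. E (\<lambda>x. G n (act (along i a) x) * G n (act (along i b) x)))))
      = avg ?H (\<lambda>a. avg ?H (\<lambda>b. avg ?B (\<lambda>n. E (\<lambda>x. G n (act (along i a) x) * G n (act (along i b) x)))))"
    by (subst avg_swap, subst (2) avg_swap) rule
  also have "\<dots> = avg ?H (\<lambda>a. avg ?H (\<lambda>b.
     cube_avg D (\<lambda>J x. f (insert i J) (act (along i a) x) * f (insert i J) (act (along i b) x)) M N))"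
    unfolding cube_avg_def G_def prod.distrib[symmetric]
    by (simp add: act_act add.commute)
  finally show ?thesis .
qed

lemma cube_avg_trivial:
  assumes "finite D" and one: "\<And>K x. K \<noteq> {} \<Longrightarrow> K \<subseteq> D \<Longrightarrow> f K x = 1"
    and MN: "\<And>j. j \<in> D \<Longrightarrow> M j < N j"
  shows "cube_avg D f M N = E (f {})"
proof -
  have "(\<Prod>J\<in>Pow D. f J (act (mask J n) x)) = f {} x" for n x
  proof -
    have "(\<Prod>J\<in>Pow D. f J (act (mask J n) x)) = (\<Prod>J\<in>{{}}. f J (act (mask J n) x))"
      using assms(1) by (intro prod.mono_neutral_right) (auto intro!: one)
    then show ?thesis by (simp add: act_zero)
  qed
  then show ?thesis
    using assms by (simp add: cube_avg_def avg_const finite_grid grid_nonempty)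
qed

lemma abs_box_mean_le:
  assumes "u \<in> A" "\<And>x. \<bar>u x\<bar> \<le> 1"
  shows "\<bar>box_mean I H u\<bar> \<le> 1"
  unfolding box_mean_def by (intro abs_avg_le abs_E_le abs_prod_le_1 prod_in act_in) (use assms in auto)

text \<open>
  Iterating van der Corput's inequality over the directions \<open>i \<in> I\<close> keeps only the vertices that
  contain \<open>I\<close>, and above \<open>I\<close> the functions are \<open>1\<close>. The side lengths enter only
  through the error term, and \<open>H\<close> is fixed independently of them. The left-hand side carries no
  absolute value: for empty \<open>I\<close> it is \<open>E (f {})\<close> itself.
\<close>

lemma cube_avg_le_box_mean:
  assumes "finite I" "finite D" "I \<subseteq> D" and f: "\<And>J. J \<subseteq> D \<Longrightarrow> f J \<in> A"
    and le: "\<And>J x. J \<subseteq> D \<Longrightarrow> \<bar>f J x\<bar> \<le> 1"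
    and one: "\<And>K x. I \<subset> K \<Longrightarrow> K \<subseteq> D \<Longrightarrow> f K x = 1"
    and MN: "\<And>j. j \<in> D \<Longrightarrow> M j < N j" and H: "0 < H"
  shows "(cube_avg D f M N) ^ (2 ^ card I)
    \<le> box_mean I H (f I) + (\<Sum>i\<in>I. 2 ^ (card I + 1) * real H / real_of_int (N i - M i))"
  using assms(1-7)
proof (induction I arbitrary: D f rule: finite_induct)
  case empty
  have "cube_avg D f M N = E (f {})"
    by (intro cube_avg_trivial empty(1,5,6)) auto
  then show ?case by (simp add: box_mean_empty)
next
  case (insert i I)
  define D' where "D' = D - {i}"
  define r where "r = card I"
  have D': "D = insert i D'" "i \<notin> D'" "finite D'" "I \<subseteq> D'"
    using insert by (auto simp: D'_def)
  define g where "g = (\<lambda>a b J x. f (insert i J) (act (along i a) x) * f (insert i J) (act (along i b) x))"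
  have gA: "g a b J \<in> A" if "J \<subseteq> D'" for a b J
    unfolding g_def using that D' by (intro mult act_in insert.prems) auto
  have g1: "\<bar>g a b J x\<bar> \<le> 1" if "J \<subseteq> D'" for a b J x
    unfolding g_def abs_mult using that D'
    by (intro mult_le_one insert.prems) auto
  have gone: "g a b K x = 1" if "I \<subset> K" "K \<subseteq> D'" for a b K x
  proof -
    have "insert i I \<subset> insert i K" "insert i K \<subseteq> D" using that D' insert.hyps by auto
    then show ?thesis using insert.prems(5) by (simp add: g_def)
  qed
  let ?H = "{0..<int H}"
  let ?X = "avg ?H (\<lambda>a. avg ?H (\<lambda>b. cube_avg D' (g a b) M N))"
  let ?err = "4 * real H / real_of_int (N i - M i)"
  let ?S = "cube_avg D f M N"
  have len: "M i < N i" using insert.prems by auto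
  have S1: "\<bar>?S\<bar> \<le> 1" by (intro abs_cube_avg_le insert.prems)
  have X1: "\<bar>?X\<bar> \<le> 1" by (intro abs_avg_le abs_cube_avg_le gA g1) auto
  have vdc: "?S\<^sup>2 \<le> ?X + ?err"
    unfolding D'(1) g_def
    by (rule van_der_Corput_cube) (use D' insert.prems H in auto)
  have IH: "(cube_avg D' (g a b) M N) ^ (2 ^ r)
      \<le> box_mean I H (g a b I) + (\<Sum>j\<in>I. 2 ^ (r + 1) * real H / real_of_int (N j - M j))" for a b
    unfolding r_def
    by (rule insert.IH) (use D' gA g1 gone insert.prems in auto)
  define y where "y = min 1 (?X + ?err)"
  have err0: "0 \<le> ?err" using len by auto
  \<comment> \<open>The cap keeps both numbers in the unit interval, where powers are Lipschitz.\<close>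
  have y: "?S\<^sup>2 \<le> y" "y \<le> 1" "\<bar>y - ?X\<bar> \<le> ?err"
    using vdc S1 X1 err0 by (auto simp: y_def abs_square_le_1)
  have y0: "0 \<le> y" using order_trans[OF zero_le_power2 y(1)] .
  have "?S ^ (2 ^ Suc r) = (?S\<^sup>2) ^ (2 ^ r)" by (simp add: power_mult)
  also have "\<dots> \<le> y ^ (2 ^ r)" by (intro power_mono y(1)) auto
  also have "\<dots> \<le> ?X ^ (2 ^ r) + 2 ^ r * ?err"
  proof -
    have "norm (y ^ (2 ^ r) - ?X ^ (2 ^ r)) \<le> (2 ^ r :: nat) * norm (y - ?X)"
      by (rule norm_power_diff) (use y y0 X1 in auto)
    also have "\<dots> \<le> 2 ^ r * ?err" using mult_left_mono[OF y(3), of "2 ^ r"] by simp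
    finally show ?thesis by simp
  qed
  also have "?X ^ (2 ^ r) \<le> avg ?H (\<lambda>a. avg ?H (\<lambda>b. (cube_avg D' (g a b) M N) ^ (2 ^ r)))"
    by (rule order_trans[OF power_avg_le]) (intro avg_mono power_avg_le)
  also have "\<dots> \<le> avg ?H (\<lambda>a. avg ?H (\<lambda>b. box_mean I H (g a b I) + (\<Sum>j\<in>I. 2 ^ (r + 1) * real H / real_of_int (N j - M j))))"
    by (intro avg_mono IH)
  also have "\<dots> = box_mean (insert i I) H (f (insert i I)) + (\<Sum>j\<in>I. 2 ^ (r + 1) * real H / real_of_int (N j - M j))"
    using H insert by (simp add: avg_add avg_const box_mean_insert g_def)
  also have "(\<Sum>j\<in>I. 2 ^ (r + 1) * real H / real_of_int (N j - M j)) \<le> (\<Sum>j\<in>I. 2 ^ (Suc r + 1) * real H / real_of_int (N j - M j))"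
  proof (intro sum_mono divide_right_mono mult_right_mono)
    fix j assume "j \<in> I"
    then show "0 \<le> real_of_int (N j - M j)" using insert.prems(2) insert.prems(6)[of j] by auto
  qed auto
  finally show ?case
    using insert.hyps by (simp add: r_def mult_ac)
qed

end

section \<open>The lower bound\<close>

context zsystem
begin

text \<open>
  Put \<open>u\<close> at the top vertex and \<open>1\<close> elsewhere. All averages then equal \<open>E u\<close>, and the error
  term of \<open>cube_avg_le_box_mean\<close> disappears when the box grows.
\<close>

lemma box_mean_ge:
  assumes D: "finite D" and u: "u \<in> A" "\<And>x. \<bar>u x\<bar> \<le> 1" and H: "0 < H"
  shows "(E u) ^ (2 ^ card D) \<le> box_mean D H u"
proof -
  define f where "f = (\<lambda>K. if K = D then u else (\<lambda>_. 1))"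
  define c where "c = (\<Sum>i\<in>D. 2 ^ (card D + 1) * real H)"
  have S: "cube_avg D f (\<lambda>_. 0) (\<lambda>_. int L) = E u" if "0 < L" for L
  proof -
    have "(\<Prod>J\<in>Pow D. f J (act (mask J n) x)) = u (act (mask D n) x)" for n x
      using D by (subst prod.remove[of _ D]) (auto simp: f_def intro!: prod.neutral)
    then show ?thesis
      unfolding cube_avg_def using that D
      by (simp add: E_act[OF u(1)] avg_const finite_grid grid_nonempty)
  qed
  have "(E u) ^ (2 ^ card D) \<le> box_mean D H u + c / real L" if L: "0 < L" for L :: nat
  proof -
    have "(cube_avg D f (\<lambda>_. 0) (\<lambda>_. int L)) ^ (2 ^ card D) \<le> box_mean D H (f D)
       + (\<Sum>i\<in>D. 2 ^ (card D + 1) * real H / real_of_int (int L - 0))"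
      by (rule cube_avg_le_box_mean) (use D u H L in \<open>auto simp: f_def const\<close>)
    then show ?thesis unfolding S[OF L] by (simp add: c_def f_def sum_divide_distrib)
  qed
  moreover have "(\<lambda>L. box_mean D H u + c / real L) \<longlonglongrightarrow> box_mean D H u + 0"
    by (intro tendsto_intros lim_const_over_n)
  ultimately show ?thesis
    by (intro LIMSEQ_le_const[of _ _ "(E u) ^ (2 ^ card D)"]) (auto intro!: exI[of _ 1])
qed

text \<open>
  For fixed \<open>m\<close> the vectors \<open>n - m\<close> fill a translate of the box, so the box mean is a mean of
  cube averages over translates with the same side length.
\<close>

lemma box_mean_le_cube_avg:
  assumes D: "finite D" and H: "0 < H"
  shows "\<exists>M N. (\<forall>i. N i - M i = int H) \<and> box_mean D H u \<le> cube_avg D (\<lambda>_. u) M N"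
proof -
  let ?G = "grid D (\<lambda>_. 0) (\<lambda>_. int H)"
  define g where "g = (\<lambda>k. E (\<lambda>x. \<Prod>J\<in>Pow D. u (act (mask J k) x)))"
  have g: "g (mask D k) = g k" for k
  proof -
    have "(\<Prod>J\<in>Pow D. u (act (mask J (mask D k)) x)) = (\<Prod>J\<in>Pow D. u (act (mask J k) x))" for x
    proof (rule prod.cong[OF refl])
      fix J assume "J \<in> Pow D"
      then have "mask J (mask D k) = mask J k" by (auto simp: mask_def fun_eq_iff)
      then show "u (act (mask J (mask D k)) x) = u (act (mask J k) x)" by simp
    qed
    then show ?thesis by (simp add: g_def)
  qed
  have "cube_avg D (\<lambda>_. u) (\<lambda>i. - m i) (\<lambda>i. int H - m i) = avg ?G (\<lambda>n. g (\<lambda>i. n i - m i))" for m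
    using avg_grid_translate[of D m "int H" g, unfolded g] by (simp add: cube_avg_def g_def)
  then have "box_mean D H u = avg ?G (\<lambda>m. cube_avg D (\<lambda>_. u) (\<lambda>i. - m i) (\<lambda>i. int H - m i))"
    unfolding box_mean_def g_def by simp
  moreover have "finite ?G" "?G \<noteq> {}" using D H by (auto simp: finite_grid grid_nonempty)
  ultimately obtain m where "box_mean D H u \<le> cube_avg D (\<lambda>_. u) (\<lambda>i. - m i) (\<lambda>i. int H - m i)"
    using avg_le_some by metis
  then show ?thesis
    by (intro exI[of _ "\<lambda>i. - m i"] exI[of _ "\<lambda>i. int H - m i"]) simp
qed

end

section \<open>Extending a system by a box of shifts\<close>

text \<open>
  The mean of a function of the shift \<open>h\<close> with the weights of \<open>box_mean\<close>.
\<close>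

definition diff_mean :: "nat set \<Rightarrow> nat \<Rightarrow> ((nat \<Rightarrow> int) \<Rightarrow> real) \<Rightarrow> real" where
  "diff_mean I H a = avg (grid I (\<lambda>_. 0) (\<lambda>_. int H)) (\<lambda>m. avg (grid I (\<lambda>_. 0) (\<lambda>_. int H))
     (\<lambda>n. a (mask I (\<lambda>i. n i - m i))))"

lemma diff_mean_add: "diff_mean I H (\<lambda>h. a h + b h) = diff_mean I H a + diff_mean I H b"
  by (simp add: diff_mean_def avg_add)

lemma diff_mean_cmult: "diff_mean I H (\<lambda>h. c * a h) = c * diff_mean I H a"
  by (simp add: diff_mean_def avg_cmult)

lemma abs_diff_mean_le: "(\<And>h. \<bar>a h\<bar> \<le> C) \<Longrightarrow> \<bar>diff_mean I H a\<bar> \<le> C"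
  unfolding diff_mean_def by (intro abs_avg_le) (auto intro: order_trans[OF abs_ge_zero])

lemma diff_mean_const: "finite I \<Longrightarrow> 0 < H \<Longrightarrow> diff_mean I H (\<lambda>_. c) = c"
  unfolding diff_mean_def by (simp add: avg_const finite_grid grid_nonempty)

lemma diff_mean_nonneg: "(\<And>h. 0 \<le> a h) \<Longrightarrow> 0 \<le> diff_mean I H a"
  unfolding diff_mean_def avg_def by (intro divide_nonneg_nonneg sum_nonneg) auto

lemma diff_mean_shift_along:
  assumes I: "finite I" "i \<in> I" and le: "\<And>h. \<bar>a h\<bar> \<le> C" and H: "0 < H"
  shows "\<bar>diff_mean I H (\<lambda>h. a (\<lambda>j. h j + along i k j)) - diff_mean I H a\<bar> \<le> 2 * C * \<bar>k\<bar> / H"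
proof -
  define I' where "I' = I - {i}"
  have I': "I = insert i I'" "finite I'" "i \<notin> I'" using I by (auto simp: I'_def)
  have C: "0 \<le> C" using order_trans[OF abs_ge_zero le] .
  let ?G = "grid I (\<lambda>_. 0) (\<lambda>_. int H)" and ?G' = "grid I' (\<lambda>_. 0) (\<lambda>_. int H)"
  define b where "b = (\<lambda>m y. avg ?G' (\<lambda>n. a (mask I (\<lambda>j. (n(i := y)) j - m j))))"
  have upd: "(\<lambda>j. mask I (\<lambda>j. (n(i := y)) j - m j) j + along i k j) = mask I (\<lambda>j. (n(i := y + k)) j - m j)"
    for n m :: "nat \<Rightarrow> int" and y
    using I by (auto simp: mask_def along_def)
  have 1: "diff_mean I H (\<lambda>h. a (\<lambda>j. h j + along i k j)) = avg ?G (\<lambda>m. avg {0..<int H} (\<lambda>y. b m (y + k)))"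
    unfolding diff_mean_def b_def
    by (intro avg_cong refl) (simp only: I'(1) avg_grid_insert[OF I'(2,3)] upd[unfolded I'(1)])
  have 2: "diff_mean I H a = avg ?G (\<lambda>m. avg {0..<int H} (b m))"
    unfolding diff_mean_def b_def
    by (intro avg_cong refl) (simp only: I'(1) avg_grid_insert[OF I'(2,3)])
  have b: "\<bar>b m y\<bar> \<le> C" for m y
    unfolding b_def by (intro abs_avg_le le C)
  have "\<bar>avg ?G (\<lambda>m. avg {0..<int H} (\<lambda>y. b m (y + k)) - avg {0..<int H} (b m))\<bar> \<le> 2 * C * \<bar>k\<bar> / H"
    using avg_shift[OF b, of 0 "int H"] H C by (intro abs_avg_le) auto
  then show ?thesis unfolding 1 2 avg_diff .
qed

lemma diff_mean_shift:
  assumes I: "finite I" "J \<subseteq> I" and le: "\<And>h. \<bar>a h\<bar> \<le> C" and H: "0 < H"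
  shows "\<bar>diff_mean I H (\<lambda>h. a (\<lambda>j. h j + mask J v j)) - diff_mean I H a\<bar>
    \<le> 2 * C * (\<Sum>j\<in>J. \<bar>v j\<bar>) / H"
proof -
  have "finite J" using I finite_subset by blast
  then show ?thesis using I(2)
  proof (induction J rule: finite_induct)
    case (insert i J)
    let ?a = "\<lambda>h. a (\<lambda>j. h j + mask J v j)"
    have "(\<lambda>h. a (\<lambda>j. h j + mask (insert i J) v j)) = (\<lambda>h. ?a (\<lambda>j. h j + along i (v i) j))"
      using insert.hyps by (intro ext arg_cong[of _ _ a]) (auto simp: mask_def along_def)
    moreover have "\<bar>diff_mean I H (\<lambda>h. ?a (\<lambda>j. h j + along i (v i) j)) - diff_mean I H ?a\<bar> \<le> 2 * C * \<bar>v i\<bar> / H"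
      by (rule diff_mean_shift_along[OF I(1) _ le H]) (use insert.prems in auto)
    moreover have "\<bar>diff_mean I H ?a - diff_mean I H a\<bar> \<le> 2 * C * (\<Sum>j\<in>J. \<bar>v j\<bar>) / H"
      using insert by auto
    ultimately show ?case
      using insert.hyps by (simp add: add_divide_distrib algebra_simps)
  qed simp
qed

text \<open>
  Translating \<open>h\<close> by a fixed vector changes the means by \<open>O(1/H)\<close>. This makes the functional on
  the extension invariant.
\<close>

lemma ulim_diff_mean_shift:
  assumes "finite I" "J \<subseteq> I" and le: "\<And>h. \<bar>a h\<bar> \<le> C"
  shows "ulim (\<lambda>H. diff_mean I H (\<lambda>h. a (\<lambda>j. h j + mask J v j))) = ulim (\<lambda>H. diff_mean I H a)"
proof -
  let ?d = "\<lambda>H. diff_mean I H (\<lambda>h. a (\<lambda>j. h j + mask J v j)) - diff_mean I H a"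
  let ?c = "2 * C * (\<Sum>j\<in>J. \<bar>v j\<bar>)"
  have "?d \<longlonglongrightarrow> 0"
  proof (rule Lim_null_comparison)
    show "(\<lambda>H. ?c / real H) \<longlonglongrightarrow> 0" by (rule lim_const_over_n)
    show "eventually (\<lambda>H. norm (?d H) \<le> ?c / real H) sequentially"
      using eventually_gt_at_top[of "0::nat"]
    proof eventually_elim
      case (elim H)
      then show ?case unfolding real_norm_def by (rule diff_mean_shift[OF assms])
    qed
  qed
  then have d0: "ulim ?d = 0" by (rule ulim_eq)
  have "ulim (\<lambda>H. ?d H + diff_mean I H a) = ulim ?d + ulim (\<lambda>H. diff_mean I H a)"
  proof (rule ulim_add)
    show "\<bar>diff_mean I H a\<bar> \<le> C" for H by (intro abs_diff_mean_le le)
    show "\<bar>?d H\<bar> \<le> C + C" for H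
      by (rule order_trans[OF abs_triangle_ineq4 add_mono]) (intro abs_diff_mean_le le)+
  qed
  then show ?thesis using d0 by simp
qed

text \<open>
  The extension of a system lives on pairs of a point and an integer vector. The induction for
  convergence passes to an extension at every step and needs all of them on the same type; a
  point therefore carries a stream of vectors, and forming a pair pushes a vector onto it.
\<close>

type_synonym 'x tower = "'x \<times> (nat \<Rightarrow> int) stream"

definition base :: "'x tower \<Rightarrow> 'x tower" where "base c = (fst c, stl (snd c))"
definition par :: "'x tower \<Rightarrow> nat \<Rightarrow> int" where "par c = shd (snd c)"
definition extend :: "'x tower \<Rightarrow> (nat \<Rightarrow> int) \<Rightarrow> 'x tower" where "extend c h = (fst c, h ## snd c)"

lemma tower_simps [simp]: "base (extend c h) = c" "par (extend c h) = h" "extend (base c) (par c) = c"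
  by (simp_all add: base_def par_def extend_def)

text \<open>
  Membership is a condition on the slices with fixed new coordinate and on the bound: the mean over
  this coordinate is taken by \<open>ulim\<close>, which accepts all bounded sequences.
\<close>

definition ext_fun :: "('x tower \<Rightarrow> real) set \<Rightarrow> ('x tower \<Rightarrow> real) set" where
  "ext_fun A = {F. (\<exists>C. \<forall>c. \<bar>F c\<bar> \<le> C) \<and> (\<forall>h. (\<lambda>c. F (extend c h)) \<in> A)}"

definition ext_E :: "nat set \<Rightarrow> (('x tower \<Rightarrow> real) \<Rightarrow> real) \<Rightarrow> ('x tower \<Rightarrow> real) \<Rightarrow> real" where
  "ext_E I E F = ulim (\<lambda>H. diff_mean I H (\<lambda>h. E (\<lambda>c. F (extend c h))))"

text \<open>
  A pair \<open>(x, h)\<close> stands for the cube of points \<open>T\<^bsup>h\<cdot>(I-J)\<^esup> x\<close>, \<open>J \<subseteq> I\<close>, whose top vertex is \<open>x\<close>.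
  The vector \<open>n\<close> moves \<open>x\<close> by \<open>T\<^sup>n\<close>; subtracting \<open>n\<close> from \<open>h\<close> compensates for this motion at
  vertex \<open>J\<close> in all directions of \<open>I - J\<close>.
\<close>

definition ext_act :: "nat set \<Rightarrow> ((nat \<Rightarrow> int) \<Rightarrow> 'x tower \<Rightarrow> 'x tower) \<Rightarrow> (nat \<Rightarrow> int) \<Rightarrow> 'x tower \<Rightarrow> 'x tower" where
  "ext_act I act n c = extend (act n (base c)) (\<lambda>i. par c i - mask I n i)"

lemma base_ext_act [simp]: "base (ext_act I act n c) = act n (base c)"
  by (simp add: ext_act_def)

locale tower_system = zsystem A E act
  for A :: "('x tower \<Rightarrow> real) set" and E act
begin

lemma ext_funD: "F \<in> ext_fun A \<Longrightarrow> (\<lambda>c. F (extend c h)) \<in> A"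
  by (simp add: ext_fun_def)

lemma ext_fun_bound:
  assumes "F \<in> ext_fun A"
  shows "\<exists>C. \<forall>h. \<bar>E (\<lambda>c. F (extend c h))\<bar> \<le> C"
proof -
  obtain C where "\<forall>c. \<bar>F c\<bar> \<le> C" using assms by (auto simp: ext_fun_def)
  then have "\<bar>E (\<lambda>c. F (extend c h))\<bar> \<le> C" for h by (intro abs_E_le ext_funD assms) blast
  then show ?thesis by blast
qed

lemma tower_system_ext:
  assumes I: "finite I"
  shows "tower_system (ext_fun A) (ext_E I E) (ext_act I act)"
proof
  fix c show "(\<lambda>_. c) \<in> ext_fun A" by (auto simp: ext_fun_def const)
next
  fix F G assume FG: "F \<in> ext_fun A" "G \<in> ext_fun A"
  obtain C where C: "\<And>c. \<bar>F c\<bar> \<le> C" using FG by (auto simp: ext_fun_def)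
  obtain C' where C': "\<And>c. \<bar>G c\<bar> \<le> C'" using FG by (auto simp: ext_fun_def)
  have "\<forall>c. \<bar>F c + G c\<bar> \<le> C + C'"
    using C C' by (meson abs_triangle_ineq add_mono order_trans)
  then show "(\<lambda>x. F x + G x) \<in> ext_fun A"
    using FG by (auto simp: ext_fun_def intro!: add)
  have "\<bar>F c * G c\<bar> \<le> C * C'" for c
    unfolding abs_mult by (intro mult_mono C C') (use C[of c] in auto)
  then have "\<forall>c. \<bar>F c * G c\<bar> \<le> C * C'" by blast
  then show "(\<lambda>x. F x * G x) \<in> ext_fun A"
    using FG by (auto simp: ext_fun_def intro!: mult)
  obtain B where B: "\<And>h. \<bar>E (\<lambda>c. F (extend c h))\<bar> \<le> B" using ext_fun_bound[OF FG(1)] by blast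
  obtain B' where B': "\<And>h. \<bar>E (\<lambda>c. G (extend c h))\<bar> \<le> B'" using ext_fun_bound[OF FG(2)] by blast
  show "ext_E I E (\<lambda>x. F x + G x) = ext_E I E F + ext_E I E G"
    unfolding ext_E_def using FG
    by (simp add: E_add ext_funD diff_mean_add ulim_add[OF abs_diff_mean_le[OF B] abs_diff_mean_le[OF B']])
next
  fix F c assume F: "F \<in> ext_fun A"
  obtain B where B: "\<And>h. \<bar>E (\<lambda>c. F (extend c h))\<bar> \<le> B" using ext_fun_bound[OF F] by blast
  show "ext_E I E (\<lambda>x. c * F x) = c * ext_E I E F"
    unfolding ext_E_def using F
    by (simp add: E_cmult ext_funD diff_mean_cmult ulim_cmult[OF abs_diff_mean_le[OF B]])
next
  fix F n assume F: "F \<in> ext_fun A"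
  show "\<exists>C. \<forall>x. \<bar>F x\<bar> \<le> C" using F by (auto simp: ext_fun_def)
  obtain B where B: "\<And>h. \<bar>E (\<lambda>c. F (extend c h))\<bar> \<le> B" using ext_fun_bound[OF F] by blast
  show "(\<lambda>x. F (ext_act I act n x)) \<in> ext_fun A"
  proof -
    obtain C where "\<forall>c. \<bar>F c\<bar> \<le> C" using F by (auto simp: ext_fun_def)
    then show ?thesis
      using F act_in[of "\<lambda>c. F (extend c _)"]
      by (auto simp: ext_fun_def ext_act_def simp del: split_paired_All)
  qed
  show "ext_E I E (\<lambda>x. F (ext_act I act n x)) = ext_E I E F"
  proof -
    have "E (\<lambda>c. F (extend (act n c) h)) = E (\<lambda>c. F (extend c h))" for h
      by (rule E_act[OF ext_funD[OF F]])
    moreover have "(\<lambda>i. h i - mask I n i) = (\<lambda>i. h i + mask I (\<lambda>i. - n i) i)" for h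
      by (auto simp: mask_def)
    ultimately show ?thesis
      unfolding ext_E_def ext_act_def tower_simps
      using ulim_diff_mean_shift[OF I subset_refl, of "\<lambda>h. E (\<lambda>c. F (extend c h))", OF B] by simp
  qed
next
  fix F :: "'x tower \<Rightarrow> real" assume F: "F \<in> ext_fun A" and pos: "\<And>x. 0 \<le> F x"
  obtain B where B: "\<And>h. \<bar>E (\<lambda>c. F (extend c h))\<bar> \<le> B" using ext_fun_bound[OF F] by blast
  show "0 \<le> ext_E I E F"
    unfolding ext_E_def
    by (rule ulim_ge[OF abs_diff_mean_le[OF B]]) (intro diff_mean_nonneg E_nonneg ext_funD F pos)
next
  have "(\<lambda>H. diff_mean I H (\<lambda>_. 1)) \<longlonglongrightarrow> 1"
    by (rule tendsto_eventually, use eventually_gt_at_top[of "0::nat"] in eventually_elim)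
      (simp add: diff_mean_const I)
  then show "ext_E I E (\<lambda>_. 1) = 1" unfolding ext_E_def E_one by (rule ulim_eq)
next
  fix m n x
  show "ext_act I act m (ext_act I act n x) = ext_act I act (\<lambda>i. m i + n i) x"
    unfolding ext_act_def tower_simps act_act
    by (rule arg_cong[of _ _ "extend _"]) (auto simp: mask_def)
  show "ext_act I act (\<lambda>_. 0) x = x"
    unfolding ext_act_def act_zero by (simp add: mask_def)
qed

lemma base_in_ext: "w \<in> A \<Longrightarrow> (\<lambda>c. w (base c)) \<in> ext_fun A"
proof -
  assume w: "w \<in> A"
  then obtain C where "\<forall>x. \<bar>w x\<bar> \<le> C" using bounded by blast
  then show ?thesis using w unfolding ext_fun_def by (auto simp del: split_paired_All)
qed

lemma ext_E_base:
  assumes "finite I"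
  shows "ext_E I E (\<lambda>c. w (base c)) = E w"
proof -
  have "(\<lambda>H. diff_mean I H (\<lambda>_. E w)) \<longlonglongrightarrow> E w"
    by (rule tendsto_eventually, use eventually_gt_at_top[of "0::nat"] in eventually_elim)
      (simp add: diff_mean_const assms)
  then show ?thesis unfolding ext_E_def by (simp add: ulim_eq)
qed

definition vertex :: "nat set \<Rightarrow> nat set \<Rightarrow> 'x tower \<Rightarrow> 'x tower" where
  "vertex I J c = act (mask (I - J) (par c)) (base c)"

lemma vertex_in_ext: "u \<in> A \<Longrightarrow> (\<lambda>c. u (vertex I J c)) \<in> ext_fun A"
proof -
  assume u: "u \<in> A"
  then obtain C where "\<forall>x. \<bar>u x\<bar> \<le> C" using bounded by blast
  then show ?thesis using act_in[OF u] unfolding ext_fun_def vertex_def by (auto simp del: split_paired_All)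
qed

text \<open>
  The \<open>i\<close>-th coordinates of the motion of the top vertex and of the change of \<open>h\<close> cancel when
  \<open>i \<in> I - J\<close>.
\<close>

lemma vertex_invariant:
  assumes "J \<subseteq> I" "i \<in> I" "i \<notin> J"
  shows "vertex I J (ext_act I act (mask I n) c) = vertex I J (ext_act I act (mask (I - {i}) n) c)"
proof -
  have *: "(\<lambda>j. mask (I - J) (\<lambda>i. par c i - mask I (mask K n) i) j + mask K n j)
      = (\<lambda>j. mask (I - J) (par c) j + mask J n j)" if "K = I \<or> K = I - {i}" for K
    using assms that by (auto simp: mask_def fun_eq_iff)
  show ?thesis unfolding vertex_def ext_act_def tower_simps act_act by (simp add: *)
qed

text \<open>
  As a functional of \<open>w\<close> this is the pairing with the dual function of \<open>\<theta>\<close>, obtained by putting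
  \<open>\<theta>\<close> at all vertices of the cube but the top one.
\<close>

definition dual :: "nat set \<Rightarrow> ('x tower \<Rightarrow> real) \<Rightarrow> ('x tower \<Rightarrow> real) \<Rightarrow> real" where
  "dual I \<theta> w = ext_E I E (\<lambda>c. w (base c) * (\<Prod>J\<in>Pow I - {I}. \<theta> (vertex I J c)))"

lemma dual_self:
  assumes I: "finite I"
  shows "dual I \<theta> \<theta> = ulim (\<lambda>H. box_mean I H \<theta>)"
proof -
  have "\<theta> c * (\<Prod>J\<in>Pow I - {I}. \<theta> (vertex I J (extend c h))) = (\<Prod>J\<in>Pow I. \<theta> (act (mask J h) c))" for c h
  proof -
    have "(\<Prod>J\<in>Pow I. \<theta> (vertex I J (extend c h))) = \<theta> c * (\<Prod>J\<in>Pow I - {I}. \<theta> (vertex I J (extend c h)))"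
      using I by (subst prod.remove[of _ I]) (auto simp: vertex_def act_zero)
    also have "(\<Prod>J\<in>Pow I. \<theta> (vertex I J (extend c h))) = (\<Prod>J\<in>Pow I. \<theta> (act (mask J h) c))"
      by (rule prod.reindex_bij_witness[of _ "\<lambda>J. I - J" "\<lambda>J. I - J"]) (auto simp: vertex_def double_diff)
    finally show ?thesis by simp
  qed
  moreover have "(\<Prod>J\<in>Pow I. \<theta> (act (mask J (mask I h)) c)) = (\<Prod>J\<in>Pow I. \<theta> (act (mask J h) c))" for h c
  proof (rule prod.cong[OF refl])
    fix J assume "J \<in> Pow I"
    then have "mask J (mask I h) = mask J h" by (auto simp: mask_def fun_eq_iff)
    then show "\<theta> (act (mask J (mask I h)) c) = \<theta> (act (mask J h) c)" by simp
  qed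
  ultimately show ?thesis
    unfolding dual_def ext_E_def box_mean_def diff_mean_def by simp
qed

end

section \<open>A criterion for weak convergence\<close>

text \<open>
  Closure under midpoints is all of convexity that the parallelogram law requires.
\<close>

inductive_set mids :: "('c \<Rightarrow> real) set \<Rightarrow> ('c \<Rightarrow> real) set" for Q where
  gen: "\<theta> \<in> Q \<Longrightarrow> \<theta> \<in> mids Q"
| mid: "a \<in> mids Q \<Longrightarrow> b \<in> mids Q \<Longrightarrow> (\<lambda>x. 1/2 * a x + 1/2 * b x) \<in> mids Q"

lemma mids_mono:
  assumes "Q \<subseteq> Q'" shows "mids Q \<subseteq> mids Q'"
proof
  fix \<theta> assume "\<theta> \<in> mids Q"
  then show "\<theta> \<in> mids Q'"
  proof induction
    case (gen \<theta>)
    then show ?case using assms by (intro mids.gen) auto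
  qed (rule mids.mid)
qed

context zsystem
begin

lemma lin_in: "a \<in> A \<Longrightarrow> b \<in> A \<Longrightarrow> (\<lambda>x. c * a x + d * b x) \<in> A"
  by (intro add cmult)

lemma E_lin: "a \<in> A \<Longrightarrow> b \<in> A \<Longrightarrow> E (\<lambda>x. c * a x + d * b x) = c * E a + d * E b"
  by (simp add: E_add E_cmult cmult)

text \<open>
  By the parallelogram law, two elements of a midpoint-closed set whose norms are close to the
  infimum are close to each other. The infima over the decreasing sets increase to a limit, so
  from some index on this applies to elements of different sets as well. It replaces the
  strong convergence of convex combinations of a weakly convergent sequence.
\<close>

lemma near_minimizers:
  fixes C :: "nat \<Rightarrow> ('c \<Rightarrow> real) set"
  assumes ne: "\<And>K. C K \<noteq> {}" and dec: "\<And>K L. K \<le> L \<Longrightarrow> C L \<subseteq> C K" and CA: "\<And>K. C K \<subseteq> A"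
    and mid: "\<And>K a b. a \<in> C K \<Longrightarrow> b \<in> C K \<Longrightarrow> (\<lambda>x. 1/2 * a x + 1/2 * b x) \<in> C K"
    and le: "\<And>K a x. a \<in> C K \<Longrightarrow> \<bar>a x\<bar> \<le> 1" and \<rho>: "0 < \<rho>"
  shows "\<exists>K0 t. (\<forall>K. t K \<in> C K) \<and> (\<forall>K\<ge>K0. E (\<lambda>x. (t K0 x - t K x)\<^sup>2) \<le> \<rho>)"
proof -
  let ?n = "\<lambda>a. E (\<lambda>x. (a x)\<^sup>2)"
  define q where "q = (\<lambda>K. Inf (?n ` C K))"
  have n0: "0 \<le> ?n a" and n1: "?n a \<le> 1" if "a \<in> C K" for a K
  proof -
    have "a \<in> A" using that CA by auto
    then show "0 \<le> ?n a" by (intro E_nonneg power2) auto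
    have "?n a \<le> E (\<lambda>_. 1)"
      using le[OF that] \<open>a \<in> A\<close> by (intro E_mono power2 const) (auto simp: abs_square_le_1)
    then show "?n a \<le> 1" by (simp add: E_one)
  qed
  have bdd: "bdd_below (?n ` C K)" for K
    using n0 by (intro bdd_belowI[of _ 0]) auto
  have q_le: "q K \<le> ?n a" if "a \<in> C K" for a K
    unfolding q_def using that bdd by (intro cInf_lower) auto
  have q1: "q K \<le> 1" for K
  proof -
    obtain a where "a \<in> C K" using ne by blast
    then show ?thesis using q_le n1 order_trans by blast
  qed
  have bq: "bdd_above (range q)" using q1 by (intro bdd_aboveI[of _ 1]) auto
  define d where "d = Sup (range q)"
  have qd: "q K \<le> d" for K unfolding d_def by (intro cSup_upper bq) auto
  have "d - \<rho>/8 < Sup (range q)" using \<rho> by (simp add: d_def)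
  then obtain K0 where K0: "d - \<rho>/8 < q K0"
    using less_cSup_iff[OF _ bq, of "d - \<rho>/8"] by auto
  have "\<exists>a\<in>C K. ?n a < q K + \<rho>/8" for K
  proof -
    have "Inf (?n ` C K) < q K + \<rho>/8" using \<rho> by (simp add: q_def)
    then show ?thesis using cInf_less_iff[OF _ bdd, of K "q K + \<rho>/8"] ne by auto
  qed
  then obtain t where t: "\<And>K. t K \<in> C K" "\<And>K. ?n (t K) < q K + \<rho>/8" by metis
  have "E (\<lambda>x. (t K0 x - t K x)\<^sup>2) \<le> \<rho>" if "K0 \<le> K" for K
  proof -
    let ?m = "\<lambda>x. 1/2 * t K0 x + 1/2 * t K x"
    have tA: "t K0 \<in> A" "t K \<in> A" using t CA by auto
    have "t K \<in> C K0" using t dec[OF that] by auto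
    then have m: "?m \<in> C K0" using t mid by auto
    then have mA: "?m \<in> A" using CA by auto
    have "(\<lambda>x. (t K0 x - t K x)\<^sup>2) = (\<lambda>x. (2 * (t K0 x)\<^sup>2 + 2 * (t K x)\<^sup>2) - 4 * (?m x)\<^sup>2)"
      by (auto simp: power2_eq_square field_simps)
    then have "E (\<lambda>x. (t K0 x - t K x)\<^sup>2) = 2 * ?n (t K0) + 2 * ?n (t K) - 4 * ?n ?m"
      by (simp only: E_diff E_add E_cmult add cmult power2 tA mA)
    also have "\<dots> \<le> 2 * (d + \<rho>/8) + 2 * (d + \<rho>/8) - 4 * (d - \<rho>/8)"
    proof (intro diff_mono add_mono mult_left_mono)
      show "?n (t K0) \<le> d + \<rho>/8" "?n (t K) \<le> d + \<rho>/8"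
        using t(2)[of K0] t(2)[of K] qd[of K0] qd[of K] by linarith+
      show "d - \<rho>/8 \<le> ?n ?m" by (rule order_trans[OF less_imp_le[OF K0] q_le[OF m]])
    qed auto
    finally show ?thesis by simp
  qed
  then show ?thesis using t(1) by blast
qed

text \<open>
  Here \<open>\<delta> \<theta>\<close> is the pairing with the dual function of \<open>\<theta>\<close>. Suppose that the \<open>\<psi> b\<close> had two
  different weak limit points, with difference \<open>\<theta>\<close>. Then \<open>\<delta> \<theta> \<theta> = 0\<close>, because \<open>\<delta> \<theta>\<close> is
  weakly continuous and converges along \<open>\<psi> b\<close>; by \<open>dom\<close> the limit of \<open>E (\<theta> \<psi>\<^sub>b)\<close> is zero,
  and therefore \<open>E (\<theta> \<theta>) = 0\<close>. As the space is not complete, \<open>\<theta>\<close> is replaced by an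
  almost shortest midpoint combination of late differences \<open>\<psi> b - \<psi> b'\<close> that keep a
  fixed distance from zero when paired with \<open>u\<close>. Later combinations \<open>t K\<close> are close to \<open>\<theta>\<close> in
  norm, and it is these that are evaluated by \<open>\<delta> \<theta>\<close> and by \<open>E (\<theta> \<cdot>)\<close>.
\<close>

lemma weak_Cauchy_criterion:
  fixes \<psi> :: "'b \<Rightarrow> 'c \<Rightarrow> real" and late :: "nat \<Rightarrow> 'b set"
    and \<delta> :: "('c \<Rightarrow> real) \<Rightarrow> ('c \<Rightarrow> real) \<Rightarrow> real"
  assumes \<psi>A: "\<And>b. \<psi> b \<in> A" and \<psi>1: "\<And>b x. \<bar>\<psi> b x\<bar> \<le> 1"
    and dec: "\<And>K L. K \<le> L \<Longrightarrow> late L \<subseteq> late K"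
    and u: "u \<in> A" "\<And>x. \<bar>u x\<bar> \<le> 1"
    and lin: "\<And>\<theta> a b c d. \<theta> \<in> A \<Longrightarrow> (\<And>x. \<bar>\<theta> x\<bar> \<le> 1) \<Longrightarrow> a \<in> A \<Longrightarrow> b \<in> A \<Longrightarrow>
        \<delta> \<theta> (\<lambda>x. c * a x + d * b x) = c * \<delta> \<theta> a + d * \<delta> \<theta> b"
    and cont: "\<And>\<theta> w. \<theta> \<in> A \<Longrightarrow> (\<And>x. \<bar>\<theta> x\<bar> \<le> 1) \<Longrightarrow> w \<in> A \<Longrightarrow> (\<delta> \<theta> w)\<^sup>2 \<le> E (\<lambda>x. (w x)\<^sup>2)"
    and conv: "\<And>\<theta> e. \<theta> \<in> A \<Longrightarrow> (\<And>x. \<bar>\<theta> x\<bar> \<le> 1) \<Longrightarrow> 0 < e \<Longrightarrow>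
        \<exists>K. \<forall>b\<in>late K. \<forall>b'\<in>late K. \<bar>\<delta> \<theta> (\<psi> b) - \<delta> \<theta> (\<psi> b')\<bar> \<le> e"
    and dom: "\<And>\<theta> e. \<theta> \<in> A \<Longrightarrow> (\<And>x. \<bar>\<theta> x\<bar> \<le> 1) \<Longrightarrow> 0 < e \<Longrightarrow>
        \<exists>K. \<forall>b\<in>late K. (E (\<lambda>x. \<theta> x * \<psi> b x)) ^ q \<le> \<delta> \<theta> \<theta> + e"
    and q: "even q" "0 < q" and e: "0 < e"
  shows "\<exists>K. \<forall>b\<in>late K. \<forall>b'\<in>late K. \<bar>E (\<lambda>x. u x * \<psi> b x) - E (\<lambda>x. u x * \<psi> b' x)\<bar> \<le> e"
proof (rule ccontr)
  assume not: "\<not> ?thesis"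
  let ?U = "\<lambda>v. E (\<lambda>x. u x * v x)"
  define Q where "Q = (\<lambda>K. {\<lambda>x. 1/2 * \<psi> b x + (-1/2) * \<psi> b' x | b b'.
      b \<in> late K \<and> b' \<in> late K \<and> e < ?U (\<psi> b) - ?U (\<psi> b')})"
  define C where "C = (\<lambda>K. mids (Q K))"
  have ne: "C K \<noteq> {}" for K
  proof -
    obtain b b' where b: "b \<in> late K" "b' \<in> late K" "e < \<bar>?U (\<psi> b) - ?U (\<psi> b')\<bar>"
      using not by (meson not_le)
    then have "e < ?U (\<psi> b) - ?U (\<psi> b') \<or> e < ?U (\<psi> b') - ?U (\<psi> b)" by linarith
    then have "Q K \<noteq> {}" using b unfolding Q_def by blast
    then show ?thesis unfolding C_def using mids.gen by blast
  qed
  have Cdec: "C L \<subseteq> C K" if "K \<le> L" for K L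
    unfolding C_def by (rule mids_mono) (use dec[OF that] in \<open>auto simp: Q_def\<close>)
  have Cprop: "\<theta> \<in> A \<and> (\<forall>x. \<bar>\<theta> x\<bar> \<le> 1) \<and> e / 2 \<le> ?U \<theta>" if "\<theta> \<in> C K" for \<theta> K
    using that unfolding C_def
  proof (induction rule: mids.induct)
    case (gen \<theta>)
    then obtain b b' where \<theta>: "\<theta> = (\<lambda>x. 1/2 * \<psi> b x + (-1/2) * \<psi> b' x)" and gap: "e < ?U (\<psi> b) - ?U (\<psi> b')"
      unfolding Q_def by blast
    have "?U \<theta> = E (\<lambda>x. 1/2 * (u x * \<psi> b x) + (-1/2) * (u x * \<psi> b' x))"
      unfolding \<theta> by (intro arg_cong[of _ _ E]) (auto simp: algebra_simps)
    also have "\<dots> = 1/2 * ?U (\<psi> b) + (-1/2) * ?U (\<psi> b')"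
      by (intro E_lin mult u \<psi>A)
    finally have "e / 2 \<le> ?U \<theta>" using gap by simp
    moreover have "\<bar>\<theta> x\<bar> \<le> 1" for x unfolding \<theta> using \<psi>1[of b x] \<psi>1[of b' x] by simp
    moreover have "\<theta> \<in> A" unfolding \<theta> by (intro lin_in \<psi>A)
    ultimately show ?case by blast
  next
    case (mid a b)
    have "?U (\<lambda>x. 1/2 * a x + 1/2 * b x) = E (\<lambda>x. 1/2 * (u x * a x) + 1/2 * (u x * b x))"
      by (intro arg_cong[of _ _ E]) (auto simp: algebra_simps)
    also have "\<dots> = 1/2 * ?U a + 1/2 * ?U b"
      using mid by (intro E_lin mult u) auto
    finally have "e / 2 \<le> ?U (\<lambda>x. 1/2 * a x + 1/2 * b x)" using mid by simp
    moreover have "\<bar>1/2 * a x + 1/2 * b x\<bar> \<le> 1" for x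
      using mid.IH(1)[THEN conjunct2, THEN conjunct1, rule_format, of x]
        mid.IH(2)[THEN conjunct2, THEN conjunct1, rule_format, of x] by simp
    moreover have "(\<lambda>x. 1/2 * a x + 1/2 * b x) \<in> A" using mid by (intro lin_in) auto
    ultimately show ?case by blast
  qed
  have CA: "C K \<subseteq> A" for K using Cprop by blast
  have C1: "\<bar>a x\<bar> \<le> 1" if "a \<in> C K" for a x K using Cprop[OF that] by blast
  have functional: "\<bar>\<Lambda> v\<bar> \<le> s"
    if v: "v \<in> C K" and \<Lambda>: "\<And>a b c d. a \<in> A \<Longrightarrow> b \<in> A \<Longrightarrow> \<Lambda> (\<lambda>x. c * a x + d * b x) = c * \<Lambda> a + d * \<Lambda> b"
      and small: "\<And>b b'. b \<in> late K \<Longrightarrow> b' \<in> late K \<Longrightarrow> \<bar>\<Lambda> (\<psi> b) - \<Lambda> (\<psi> b')\<bar> \<le> 2 * s"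
    for \<Lambda> :: "('c \<Rightarrow> real) \<Rightarrow> real" and v s K
    using v unfolding C_def
  proof (induction rule: mids.induct)
    case (gen \<theta>)
    then obtain b b' where \<theta>: "\<theta> = (\<lambda>x. 1/2 * \<psi> b x + (-1/2) * \<psi> b' x)" "b \<in> late K" "b' \<in> late K"
      unfolding Q_def by blast
    have "\<Lambda> \<theta> = 1/2 * \<Lambda> (\<psi> b) + (-1/2) * \<Lambda> (\<psi> b')" unfolding \<theta>(1) by (intro \<Lambda> \<psi>A)
    then show ?case using small[OF \<theta>(2,3)] by linarith
  next
    case (mid a b)
    have "\<Lambda> (\<lambda>x. 1/2 * a x + 1/2 * b x) = 1/2 * \<Lambda> a + 1/2 * \<Lambda> b"
      by (intro \<Lambda>) (use mid CA in \<open>auto simp: C_def\<close>)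
    then show ?case using mid.IH by linarith
  qed
  \<comment> \<open>The norm of \<open>\<theta>\<close> will turn out to be at most \<open>2 \<tau> = e\<^sup>2 / 8\<close>, while pairing with \<open>u\<close> gives at least
    \<open>(e / 2)\<^sup>2\<close>; the conditions on \<open>s\<close> serve to reach the first bound.\<close>
  define \<tau> where "\<tau> = e\<^sup>2 / 16"
  define s where "s = min 1 (min \<tau> (\<tau> ^ q / 2))"
  have \<tau>: "0 < \<tau>" using e by (simp add: \<tau>_def)
  have s: "0 < s" "s \<le> 1" "s \<le> \<tau>" "2 * s \<le> \<tau> ^ q" using \<tau> by (auto simp: s_def)
  have Cmid: "(\<lambda>x. 1/2 * a x + 1/2 * b x) \<in> C K" if "a \<in> C K" "b \<in> C K" for a b K
    using that unfolding C_def by (rule mids.mid)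
  have "\<exists>K0 t. (\<forall>K. t K \<in> C K) \<and> (\<forall>K\<ge>K0. E (\<lambda>x. (t K0 x - t K x)\<^sup>2) \<le> s\<^sup>2)"
  proof (rule near_minimizers)
    show "0 < s\<^sup>2" using s(1) by simp
  qed (fact ne Cdec CA Cmid C1)+
  then obtain K0 t where t: "\<And>K. t K \<in> C K" and close: "\<And>K. K0 \<le> K \<Longrightarrow> E (\<lambda>x. (t K0 x - t K x)\<^sup>2) \<le> s\<^sup>2"
    by blast
  define \<theta> where "\<theta> = t K0"
  have \<theta>A: "\<theta> \<in> A" and \<theta>1: "\<And>x. \<bar>\<theta> x\<bar> \<le> 1"
    unfolding \<theta>_def using t CA C1 by blast+
  have tA: "t K \<in> A" for K using t CA by blast
  have dA: "(\<lambda>x. \<theta> x - t K x) \<in> A" for K by (intro diff \<theta>A tA)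
  obtain K1 where K1: "\<And>b b'. b \<in> late K1 \<Longrightarrow> b' \<in> late K1 \<Longrightarrow> \<bar>\<delta> \<theta> (\<psi> b) - \<delta> \<theta> (\<psi> b')\<bar> \<le> s"
    using conv[OF \<theta>A \<theta>1 s(1)] by blast
  define L where "L = max K0 K1"
  have tL: "t L \<in> C K1" using t[of L] Cdec[of K1 L] by (auto simp: L_def)
  have "\<bar>\<delta> \<theta> (t L)\<bar> \<le> s / 2"
    by (rule functional[OF tL]) (use lin[OF \<theta>A \<theta>1] K1 in auto)
  moreover have "\<bar>\<delta> \<theta> (\<lambda>x. \<theta> x - t L x)\<bar> \<le> s"
  proof (rule power2_le_imp_le)
    have "(\<delta> \<theta> (\<lambda>x. \<theta> x - t L x))\<^sup>2 \<le> E (\<lambda>x. (\<theta> x - t L x)\<^sup>2)"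
      by (intro cont \<theta>A \<theta>1 dA)
    also have "\<dots> \<le> s\<^sup>2" unfolding \<theta>_def by (rule close) (simp add: L_def)
    finally show "\<bar>\<delta> \<theta> (\<lambda>x. \<theta> x - t L x)\<bar>\<^sup>2 \<le> s\<^sup>2" by simp
  qed (use s in simp)
  moreover have "\<delta> \<theta> \<theta> = \<delta> \<theta> (t L) + \<delta> \<theta> (\<lambda>x. \<theta> x - t L x)"
    using lin[OF \<theta>A \<theta>1 tA dA, of 1 L 1 L] by simp
  ultimately have small: "\<delta> \<theta> \<theta> \<le> s / 2 + s" by linarith
  obtain K2 where K2: "\<And>b. b \<in> late K2 \<Longrightarrow> (E (\<lambda>x. \<theta> x * \<psi> b x)) ^ q \<le> \<delta> \<theta> \<theta> + s / 2"
    using dom[OF \<theta>A \<theta>1, of "s / 2"] s(1) by auto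
  have weak: "\<bar>E (\<lambda>x. \<theta> x * \<psi> b x)\<bar> \<le> \<tau>" if "b \<in> late K2" for b
  proof (rule power_le_imp_le_base)
    obtain m where m: "q = Suc m" using q(2) gr0_implies_Suc by blast
    have "(E (\<lambda>x. \<theta> x * \<psi> b x)) ^ q \<le> \<tau> ^ q"
      using K2[OF that] small s(4) by linarith
    then show "\<bar>E (\<lambda>x. \<theta> x * \<psi> b x)\<bar> ^ Suc (q - 1) \<le> \<tau> ^ Suc (q - 1)"
      using q by (simp add: power_even_abs)
  qed (use \<tau> in simp)
  define L' where "L' = max K0 K2"
  have tL': "t L' \<in> C K2" using t[of L'] Cdec[of K2 L'] by (auto simp: L'_def)
  have lin_E: "E (\<lambda>x. \<theta> x * (c * a x + d * b x)) = c * E (\<lambda>x. \<theta> x * a x) + d * E (\<lambda>x. \<theta> x * b x)"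
    if "a \<in> A" "b \<in> A" for a b c d
  proof -
    have "E (\<lambda>x. \<theta> x * (c * a x + d * b x)) = E (\<lambda>x. c * (\<theta> x * a x) + d * (\<theta> x * b x))"
      by (intro arg_cong[of _ _ E]) (auto simp: algebra_simps)
    then show ?thesis using that by (simp add: E_lin mult \<theta>A)
  qed
  have 1: "\<bar>E (\<lambda>x. \<theta> x * t L' x)\<bar> \<le> \<tau>"
  proof (rule functional[OF tL'])
    show "\<bar>E (\<lambda>x. \<theta> x * \<psi> b x) - E (\<lambda>x. \<theta> x * \<psi> b' x)\<bar> \<le> 2 * \<tau>" if "b \<in> late K2" "b' \<in> late K2" for b b'
      using weak[OF that(1)] weak[OF that(2)] by linarith
  qed (rule lin_E)
  have \<theta>2: "E (\<lambda>x. (a x)\<^sup>2) \<le> 1" if "a \<in> A" "\<And>x. \<bar>a x\<bar> \<le> 1" for a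
    using E_mono[of "\<lambda>x. (a x)\<^sup>2" "\<lambda>_. 1"] that by (simp add: power2 const E_one abs_square_le_1)
  have nonneg2: "0 \<le> E (\<lambda>x. (a x)\<^sup>2)" if "a \<in> A" for a
    using that by (intro E_nonneg power2) auto
  have 2: "\<bar>E (\<lambda>x. \<theta> x * (\<theta> x - t L' x))\<bar> \<le> s"
  proof (rule power2_le_imp_le)
    have "(E (\<lambda>x. \<theta> x * (\<theta> x - t L' x)))\<^sup>2 \<le> E (\<lambda>x. (\<theta> x - t L' x)\<^sup>2)"
      by (intro power2_E_mult_le \<theta>A dA \<theta>1)
    also have "\<dots> \<le> s\<^sup>2" unfolding \<theta>_def by (rule close) (simp add: L'_def)
    finally show "\<bar>E (\<lambda>x. \<theta> x * (\<theta> x - t L' x))\<bar>\<^sup>2 \<le> s\<^sup>2" by simp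
  qed (use s in simp)
  have "E (\<lambda>x. (\<theta> x)\<^sup>2) = E (\<lambda>x. \<theta> x * t L' x) + E (\<lambda>x. \<theta> x * (\<theta> x - t L' x))"
    using lin_E[OF tA dA, of 1 L' 1 L'] by (simp add: power2_eq_square)
  then have "E (\<lambda>x. (\<theta> x)\<^sup>2) \<le> 2 * \<tau>" using 1 2 s(3) by linarith
  moreover have "(e / 2)\<^sup>2 \<le> E (\<lambda>x. (\<theta> x)\<^sup>2)"
  proof -
    have "e / 2 \<le> ?U \<theta>" using Cprop[OF t[of K0]] by (simp add: \<theta>_def)
    then have "(e / 2)\<^sup>2 \<le> (?U \<theta>)\<^sup>2" using e by (intro power_mono) auto
    also have "\<dots> \<le> E (\<lambda>x. (\<theta> x)\<^sup>2)" by (intro power2_E_mult_le u \<theta>A)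
    finally show ?thesis .
  qed
  moreover have "(e / 2)\<^sup>2 = e\<^sup>2 / 4" "0 < e\<^sup>2" using e by (simp_all add: power_divide)
  ultimately show False unfolding \<tau>_def by linarith
qed

text \<open>
  The average of the functions at all vertices but \<open>I\<close>, translated back by \<open>n\<cdot>I\<close> so that the
  function at \<open>I\<close> stays fixed.
\<close>

definition face_avg :: "nat set \<Rightarrow> nat set \<Rightarrow> (nat set \<Rightarrow> 'c \<Rightarrow> real) \<Rightarrow> (nat \<Rightarrow> int) \<Rightarrow> (nat \<Rightarrow> int) \<Rightarrow> 'c \<Rightarrow> real" where
  "face_avg D I f M N x = avg (grid D M N)
     (\<lambda>n. \<Prod>J\<in>Pow D - {I}. f J (act (\<lambda>j. mask J n j - mask I n j) x))"

lemma face_avg_in: "(\<And>J. J \<subseteq> D \<Longrightarrow> f J \<in> A) \<Longrightarrow> face_avg D I f M N \<in> A"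
  unfolding face_avg_def[abs_def] by (intro avg_in prod_in act_in) auto

lemma abs_face_avg_le: "(\<And>J x. J \<subseteq> D \<Longrightarrow> \<bar>f J x\<bar> \<le> 1) \<Longrightarrow> \<bar>face_avg D I f M N x\<bar> \<le> 1"
  unfolding face_avg_def by (intro abs_avg_le abs_prod_le_1) auto

lemma E_mult_face_avg:
  assumes D: "finite D" "I \<subseteq> D" and f: "\<And>J. J \<subseteq> D \<Longrightarrow> f J \<in> A" and v: "v \<in> A"
  shows "E (\<lambda>x. v x * face_avg D I f M N x) = cube_avg D (f(I := v)) M N"
proof -
  let ?P = "\<lambda>n x. \<Prod>J\<in>Pow D - {I}. f J (act (\<lambda>j. mask J n j - mask I n j) x)"
  have PA: "?P n \<in> A" for n by (intro prod_in act_in f) auto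
  have *: "E (\<lambda>x. \<Prod>J\<in>Pow D. (f(I := v)) J (act (mask J n) x)) = E (\<lambda>x. v x * ?P n x)" for n
  proof -
    have "(\<Prod>J\<in>Pow D. (f(I := v)) J (act (mask J n) x))
        = v (act (mask I n) x) * ?P n (act (mask I n) x)" for x
      using D by (subst prod.remove[of _ I]) (auto simp: act_act intro!: prod.cong)
    then show ?thesis using E_act[OF mult[OF v PA]] by simp
  qed
  have "E (\<lambda>x. v x * face_avg D I f M N x) = E (\<lambda>x. avg (grid D M N) (\<lambda>n. v x * ?P n x))"
    unfolding face_avg_def avg_cmult ..
  also have "\<dots> = avg (grid D M N) (\<lambda>n. E (\<lambda>x. v x * ?P n x))"
    by (intro E_avg mult v PA)
  finally show ?thesis unfolding cube_avg_def * .
qed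

end

section \<open>Convergence of the cube averages\<close>

definition large_boxes :: "nat set \<Rightarrow> nat \<Rightarrow> ((nat \<Rightarrow> int) \<times> (nat \<Rightarrow> int)) set" where
  "large_boxes D K = {(M, N). \<forall>i\<in>D. M i < N i \<and> int K \<le> N i - M i}"

lemma large_boxes_mono: "K \<le> L \<Longrightarrow> large_boxes D L \<subseteq> large_boxes D K"
  by (force simp: large_boxes_def)

context tower_system
begin

text \<open>
  The limit along the ultrafilter of the box means is \<open>dual I \<theta> \<theta>\<close>, so some \<open>H\<close> has a box mean
  not much larger. With this \<open>H\<close> fixed, the error in \<open>cube_avg_le_box_mean\<close> tends to zero.
\<close>

lemma dual_dominates:
  assumes D: "finite D" "I \<subseteq> D" and f: "\<And>J. J \<subseteq> D \<Longrightarrow> f J \<in> A"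
    and le: "\<And>J x. J \<subseteq> D \<Longrightarrow> \<bar>f J x\<bar> \<le> 1"
    and one: "\<And>K x. I \<subset> K \<Longrightarrow> K \<subseteq> D \<Longrightarrow> f K x = 1"
    and \<theta>: "\<theta> \<in> A" "\<And>x. \<bar>\<theta> x\<bar> \<le> 1" and e: "0 < e"
  shows "\<exists>K. \<forall>(M, N)\<in>large_boxes D K. (E (\<lambda>x. \<theta> x * face_avg D I f M N x)) ^ (2 ^ card I) \<le> dual I \<theta> \<theta> + e"
proof -
  have I: "finite I" using D finite_subset by blast
  have "\<exists>H>0. box_mean I H \<theta> < dual I \<theta> \<theta> + e / 2"
  proof (rule ccontr)
    assume "\<not> ?thesis"
    then have "dual I \<theta> \<theta> + e / 2 \<le> ulim (\<lambda>H. box_mean I H \<theta>)"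
      by (intro ulim_ge[OF abs_box_mean_le[OF \<theta>]]) (meson not_less)
    then show False using e by (simp add: dual_self[OF I])
  qed
  then obtain H where H: "0 < H" "box_mean I H \<theta> < dual I \<theta> \<theta> + e / 2" by blast
  define c where "c = 2 ^ (card I + 1) * real H"
  have c: "0 \<le> c" by (simp add: c_def)
  obtain K :: nat where K: "real (card I) * c / (e / 2) < K" using reals_Archimedean2 by blast
  then have K0: "0 < real K"
    using c e by (intro le_less_trans[OF _ K]) auto
  have "(E (\<lambda>x. \<theta> x * face_avg D I f M N x)) ^ (2 ^ card I) \<le> dual I \<theta> \<theta> + e"
    if MN: "(M, N) \<in> large_boxes D K" for M N
  proof -
    have len: "M i < N i" "real K \<le> real_of_int (N i - M i)" if "i \<in> D" for i
    proof -
      show "M i < N i" using MN that by (auto simp: large_boxes_def)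
      have "int K \<le> N i - M i" using MN that by (auto simp: large_boxes_def)
      then show "real K \<le> real_of_int (N i - M i)" by linarith
    qed
    have "(cube_avg D (f(I := \<theta>)) M N) ^ (2 ^ card I) \<le> box_mean I H ((f(I := \<theta>)) I)
        + (\<Sum>i\<in>I. 2 ^ (card I + 1) * real H / real_of_int (N i - M i))"
      by (rule cube_avg_le_box_mean) (use I D f le one \<theta> H len in auto)
    also have "(\<Sum>i\<in>I. 2 ^ (card I + 1) * real H / real_of_int (N i - M i)) \<le> (\<Sum>i\<in>I. c / K)"
    proof (rule sum_mono)
      fix i assume "i \<in> I"
      then have "i \<in> D" using D by auto
      show "2 ^ (card I + 1) * real H / real_of_int (N i - M i) \<le> c / K"
        unfolding c_def[symmetric] by (intro divide_left_mono c len mult_pos_pos K0) (use len[OF \<open>i \<in> D\<close>] \<open>i \<in> D\<close> in auto)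
    qed
    also have "(\<Sum>i\<in>I. c / K) \<le> e / 2"
      using K K0 e by (simp add: field_simps)
    finally have "(cube_avg D (f(I := \<theta>)) M N) ^ (2 ^ card I) \<le> dual I \<theta> \<theta> + e"
      using H(2) by simp
    moreover have "E (\<lambda>x. \<theta> x * face_avg D I f M N x) = cube_avg D (f(I := \<theta>)) M N"
      by (rule E_mult_face_avg[OF D f \<theta>(1)])
    ultimately show ?thesis by simp
  qed
  then show ?thesis by blast
qed

lemma dual_linear:
  assumes I: "finite I" and \<theta>: "\<theta> \<in> A" and ab: "a \<in> A" "b \<in> A"
  shows "dual I \<theta> (\<lambda>x. c * a x + d * b x) = c * dual I \<theta> a + d * dual I \<theta> b"
proof -
  interpret X: tower_system "ext_fun A" "ext_E I E" "ext_act I act" by (rule tower_system_ext[OF I])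
  let ?P = "\<lambda>c. \<Prod>J\<in>Pow I - {I}. \<theta> (vertex I J c)"
  have P: "?P \<in> ext_fun A" by (intro X.prod_in vertex_in_ext \<theta>)
  have "dual I \<theta> (\<lambda>x. c * a x + d * b x)
      = ext_E I E (\<lambda>z. c * (a (base z) * ?P z) + d * (b (base z) * ?P z))"
    unfolding dual_def by (simp add: algebra_simps)
  also have "\<dots> = c * dual I \<theta> a + d * dual I \<theta> b"
    unfolding dual_def by (intro X.E_lin X.mult base_in_ext ab P)
  finally show ?thesis .
qed

text \<open>
  The factors from the lower vertices are bounded by \<open>1\<close>, and the extension restricts to the given
  functional on functions of the base point.
\<close>

lemma dual_bounded:
  assumes I: "finite I" and \<theta>: "\<theta> \<in> A" "\<And>x. \<bar>\<theta> x\<bar> \<le> 1" and w: "w \<in> A"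
  shows "(dual I \<theta> w)\<^sup>2 \<le> E (\<lambda>x. (w x)\<^sup>2)"
proof -
  interpret X: tower_system "ext_fun A" "ext_E I E" "ext_act I act" by (rule tower_system_ext[OF I])
  let ?P = "\<lambda>c. \<Prod>J\<in>Pow I - {I}. \<theta> (vertex I J c)"
  have "(ext_E I E (\<lambda>c. ?P c * w (base c)))\<^sup>2 \<le> ext_E I E (\<lambda>c. (w (base c))\<^sup>2)"
    by (intro X.power2_E_mult_le X.prod_in vertex_in_ext \<theta> base_in_ext w abs_prod_le_1)
  also have "\<dots> = E (\<lambda>x. (w x)\<^sup>2)"
    by (rule ext_E_base[OF I, of "\<lambda>x. (w x)\<^sup>2"])
  finally show ?thesis by (simp add: dual_def mult.commute)
qed

end

text \<open>
  The functions on the extension after the vertex \<open>I\<close> has been freed: the factor coming from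
  vertex \<open>J\<close> of the dual function is invariant in every direction of \<open>I - J\<close>, and with one such
  direction \<open>i\<close> chosen it is moved to \<open>I - {i}\<close>.
\<close>

definition absorbed :: "((nat \<Rightarrow> int) \<Rightarrow> 'x tower \<Rightarrow> 'x tower) \<Rightarrow> nat set \<Rightarrow> ('x tower \<Rightarrow> real) \<Rightarrow>
    (nat set \<Rightarrow> 'x tower \<Rightarrow> real) \<Rightarrow> nat set \<Rightarrow> 'x tower \<Rightarrow> real" where
  "absorbed act I \<theta> f K c = (if K = I then 1 else f K (base c) *
     (\<Prod>J | J \<subset> I \<and> I - {SOME i. i \<in> I - J} = K. \<theta> (act (mask (I - J) (par c)) (base c))))"

context tower_system
begin

lemma absorbed_one:
  assumes U: "\<And>J J'. J \<in> U \<Longrightarrow> J' \<subseteq> J \<Longrightarrow> J' \<in> U" and "I \<in> U" "K \<notin> U - {I}"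
    and "K \<noteq> I \<Longrightarrow> f K (base c) = 1"
  shows "absorbed act I \<theta> f K c = 1"
proof (cases "K = I")
  case False
  then have "K \<notin> U" using assms by auto
  then have "{J. J \<subset> I \<and> I - {SOME i. i \<in> I - J} = K} = {}"
    using U[OF \<open>I \<in> U\<close>] by auto
  moreover have "f K (base c) = 1" using False by (rule assms(4))
  ultimately show ?thesis
    unfolding absorbed_def using False by (simp only: if_False prod.empty mult_1_right)
qed (simp add: absorbed_def)

text \<open>
  Only one function in the product involves the new coordinate, so pairing the face average with
  the dual function is a cube average on the extension with the product of the \<open>\<theta> \<circ> vertex I J\<close> at
  \<open>I\<close>. Each factor sees \<open>n\<cdot>I\<close> and \<open>n\<cdot>(I - {i})\<close> alike and can be moved.
\<close>

lemma dual_face_avg: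
  assumes D: "finite D" "I \<subseteq> D" and f: "\<And>J. J \<subseteq> D \<Longrightarrow> f J \<in> A" and \<theta>: "\<theta> \<in> A"
  shows "dual I \<theta> (face_avg D I f M N)
    = zsystem.cube_avg (ext_E I E) (ext_act I act) D (absorbed act I \<theta> f) M N"
proof -
  have I: "finite I" using D finite_subset by blast
  interpret X: tower_system "ext_fun A" "ext_E I E" "ext_act I act" by (rule tower_system_ext[OF I])
  define fb where "fb = (\<lambda>J c. f J (base c))"
  define G where "G = (\<lambda>c. \<Prod>J\<in>Pow I - {I}. \<theta> (vertex I J c))"
  define \<kappa> where "\<kappa> = (\<lambda>J. SOME i. i \<in> I - J)"
  have \<kappa>: "\<kappa> J \<in> I" "\<kappa> J \<notin> J" if "J \<subset> I" for J
  proof -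
    have "\<exists>i. i \<in> I - J" using that by auto
    then have "\<kappa> J \<in> I - J" unfolding \<kappa>_def by (rule someI_ex)
    then show "\<kappa> J \<in> I" "\<kappa> J \<notin> J" by auto
  qed
  have face: "face_avg D I f M N (base c) = X.face_avg D I fb M N c" for c
    by (simp add: face_avg_def X.face_avg_def fb_def)
  have "dual I \<theta> (face_avg D I f M N) = ext_E I E (\<lambda>c. G c * X.face_avg D I fb M N c)"
    unfolding dual_def face by (simp add: G_def mult.commute)
  also have "\<dots> = X.cube_avg D (fb(I := G)) M N"
    by (rule X.E_mult_face_avg[OF D]) (auto simp: fb_def G_def intro!: base_in_ext f X.prod_in vertex_in_ext \<theta>)
  also have "\<dots> = X.cube_avg D (absorbed act I \<theta> f) M N"
  proof -
    have "(\<Prod>K\<in>Pow D. (fb(I := G)) K (ext_act I act (mask K n) c))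
        = (\<Prod>K\<in>Pow D. absorbed act I \<theta> f K (ext_act I act (mask K n) c))" for n c
    proof -
      let ?x = "\<lambda>K. ext_act I act (mask K n) c"
      have "G (?x I) = (\<Prod>J\<in>Pow I - {I}. \<theta> (vertex I J (?x (I - {\<kappa> J}))))"
        unfolding G_def using vertex_invariant \<kappa> by (intro prod.cong refl) (metis DiffE PowD insertI1 psubsetI)
      also have "\<dots> = (\<Prod>K\<in>Pow D - {I}. \<Prod>J\<in>{J \<in> Pow I - {I}. I - {\<kappa> J} = K}. \<theta> (vertex I J (?x (I - {\<kappa> J}))))"
      proof (rule prod.group[symmetric])
        show "(\<lambda>J. I - {\<kappa> J}) ` (Pow I - {I}) \<subseteq> Pow D - {I}"
          using D(2) \<kappa>(1) by blast
      qed (use D I in auto)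
      also have "\<dots> = (\<Prod>K\<in>Pow D - {I}. \<Prod>J | J \<subset> I \<and> I - {\<kappa> J} = K. \<theta> (vertex I J (?x K)))"
        by (intro prod.cong) auto
      finally have G: "G (?x I) = \<dots>" .
      have "(\<Prod>K\<in>Pow D. (fb(I := G)) K (?x K)) = G (?x I) * (\<Prod>K\<in>Pow D - {I}. fb K (?x K))"
        using D by (subst prod.remove[of _ I]) auto
      also have "\<dots> = (\<Prod>K\<in>Pow D - {I}. absorbed act I \<theta> f K (?x K))"
        unfolding G prod.distrib[symmetric]
        by (intro prod.cong) (auto simp: absorbed_def fb_def \<kappa>_def vertex_def mult.commute)
      also have "\<dots> = (\<Prod>K\<in>Pow D. absorbed act I \<theta> f K (?x K))"
        using D by (subst (2) prod.remove[of _ I]) (auto simp: absorbed_def)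
      finally show ?thesis .
    qed
    then show ?thesis by (simp add: X.cube_avg_def)
  qed
  finally show ?thesis .
qed

end

text \<open>
  Induction on the number of vertices that may carry a nonconstant function. Freeing a maximal
  vertex keeps the set of such vertices down-closed, as the functions are moved to smaller vertices
  only.
\<close>

theorem cube_avg_Cauchy:
  fixes A :: "('x tower \<Rightarrow> real) set"
  assumes "tower_system A E act" and D: "finite D" and "U \<subseteq> Pow D"
    and "\<And>J J'. J \<in> U \<Longrightarrow> J' \<subseteq> J \<Longrightarrow> J' \<in> U"
    and "\<And>J. J \<subseteq> D \<Longrightarrow> f J \<in> A" and "\<And>J x. J \<subseteq> D \<Longrightarrow> \<bar>f J x\<bar> \<le> 1"
    and "\<And>J x. J \<subseteq> D \<Longrightarrow> J \<notin> U \<Longrightarrow> f J x = 1"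
    and "0 < e"
  shows "\<exists>K. \<forall>(M, N)\<in>large_boxes D K. \<forall>(M', N')\<in>large_boxes D K.
    \<bar>zsystem.cube_avg E act D f M N - zsystem.cube_avg E act D f M' N'\<bar> \<le> e"
  using assms(1,3-8)
proof (induction "card U" arbitrary: U A E act f e rule: less_induct)
  case less
  interpret tower_system A E act by (rule less.prems)
  note U = less.prems(2,3) and f = less.prems(4,5) and one = less.prems(6)
  have finU: "finite U" using U(1) D finite_subset by blast
  show ?case
  proof (cases "U \<subseteq> {{}}")
    case True
    have "cube_avg D f M N = E (f {})" if "(M, N) \<in> large_boxes D 0" for M N
    proof (rule cube_avg_trivial[OF D])
      show "f K x = 1" if "K \<noteq> {}" "K \<subseteq> D" for K x
        by (rule one) (use that True in auto)
    qed (use that in \<open>auto simp: large_boxes_def\<close>)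
    then show ?thesis using less.prems(7) by (intro exI[of _ 0]) auto
  next
    case False
    then obtain I0 where "I0 \<in> U" "I0 \<noteq> {}" by auto
    then obtain I where I: "I \<in> U" "I \<noteq> {}" and max: "\<And>J. J \<in> U \<Longrightarrow> I \<subseteq> J \<Longrightarrow> J = I"
      using finite_has_maximal2[OF finU, of I0] by (metis subset_empty)
    have ID: "I \<subseteq> D" using I U by auto
    have finI: "finite I" by (rule finite_subset[OF ID D])
    have cardI: "0 < card I" using I finI by (simp add: card_gt_0_iff)
    have above: "f K x = 1" if "I \<subset> K" "K \<subseteq> D" for K x
    proof -
      have "K \<notin> U" using max[of K] that by blast
      then show ?thesis by (rule one[OF that(2)])
    qed
    define \<psi> where "\<psi> = (\<lambda>(M, N). face_avg D I f M N)"
    have S: "E (\<lambda>x. f I x * \<psi> (M, N) x) = cube_avg D f M N" for M N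
      using E_mult_face_avg[OF D ID f(1) f(1)[OF ID]] by (simp add: \<psi>_def)
    have "\<exists>K. \<forall>b\<in>large_boxes D K. \<forall>b'\<in>large_boxes D K.
        \<bar>E (\<lambda>x. f I x * \<psi> b x) - E (\<lambda>x. f I x * \<psi> b' x)\<bar> \<le> e"
    proof (rule weak_Cauchy_criterion[where \<delta> = "dual I" and q = "2 ^ card I"])
      show "\<psi> b \<in> A" for b by (auto simp: \<psi>_def split: prod.split intro!: face_avg_in f)
      show "\<bar>\<psi> b x\<bar> \<le> 1" for b x by (auto simp: \<psi>_def split: prod.split intro!: abs_face_avg_le f)
      show "large_boxes D L \<subseteq> large_boxes D K" if "K \<le> L" for K L by (rule large_boxes_mono[OF that])
      show "f I \<in> A" "\<bar>f I x\<bar> \<le> 1" for x using f ID by auto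
      show "even (2 ^ card I :: nat)" "0 < (2 ^ card I :: nat)" using cardI by auto
      show "0 < e" by (rule less.prems)
    next
      fix \<theta> a b c d assume "\<theta> \<in> A" "a \<in> A" "b \<in> A"
      then show "dual I \<theta> (\<lambda>x. c * a x + d * b x) = c * dual I \<theta> a + d * dual I \<theta> b"
        by (intro dual_linear finI)
    next
      fix \<theta> w assume "\<theta> \<in> A" "\<And>x. \<bar>\<theta> x\<bar> \<le> 1" "w \<in> A"
      then show "(dual I \<theta> w)\<^sup>2 \<le> E (\<lambda>x. (w x)\<^sup>2)" by (intro dual_bounded finI)
    next
      fix \<theta> and e' :: real assume \<theta>: "\<theta> \<in> A" "\<And>x. \<bar>\<theta> x\<bar> \<le> 1" and e': "0 < e'"
      show "\<exists>K. \<forall>b\<in>large_boxes D K. (E (\<lambda>x. \<theta> x * \<psi> b x)) ^ (2 ^ card I) \<le> dual I \<theta> \<theta> + e'"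
        using dual_dominates[OF D ID f above \<theta> e'] unfolding \<psi>_def by (simp add: case_prod_unfold)
      interpret X: tower_system "ext_fun A" "ext_E I E" "ext_act I act" by (rule tower_system_ext[OF finI])
      have "\<exists>K. \<forall>(M, N)\<in>large_boxes D K. \<forall>(M', N')\<in>large_boxes D K.
          \<bar>X.cube_avg D (absorbed act I \<theta> f) M N - X.cube_avg D (absorbed act I \<theta> f) M' N'\<bar> \<le> e'"
      proof (rule less.hyps[of "U - {I}" "ext_fun A" "ext_E I E" "ext_act I act"])
        show "card (U - {I}) < card U" using I finU by (intro psubset_card_mono) auto
        show "tower_system (ext_fun A) (ext_E I E) (ext_act I act)" by (rule tower_system_ext[OF finI])
        show "U - {I} \<subseteq> Pow D" using U by auto
        show "J' \<in> U - {I}" if "J \<in> U - {I}" "J' \<subseteq> J" for J J'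
          using that U(2)[of J J'] max[of J] by auto
        show "absorbed act I \<theta> f J \<in> ext_fun A" if "J \<subseteq> D" for J
          unfolding absorbed_def[abs_def] using that
          by (cases "J = I")
            (auto intro!: X.const X.mult base_in_ext f X.prod_in vertex_in_ext[unfolded vertex_def] \<theta>)
        show "\<bar>absorbed act I \<theta> f J c\<bar> \<le> 1" if "J \<subseteq> D" for J c
        proof (cases "J = I")
          case False
          have "\<bar>f J (base c) * (\<Prod>J' | J' \<subset> I \<and> I - {SOME i. i \<in> I - J'} = J.
              \<theta> (act (mask (I - J') (par c)) (base c)))\<bar> \<le> 1"
            unfolding abs_mult by (intro mult_le_one f(2)[OF that] abs_prod_le_1 \<theta>(2) abs_ge_zero)
          then show ?thesis using False by (simp only: absorbed_def if_False)
        qed (simp add: absorbed_def)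
        show "absorbed act I \<theta> f J c = 1" if "J \<subseteq> D" "J \<notin> U - {I}" for J c
        proof (rule absorbed_one[OF U(2) I(1) that(2)])
          show "f J (base c) = 1" if "J \<noteq> I"
            by (rule one) (use \<open>J \<subseteq> D\<close> \<open>J \<notin> U - {I}\<close> that in auto)
        qed
        show "0 < e'" by (rule e')
      qed
      then show "\<exists>K. \<forall>b\<in>large_boxes D K. \<forall>b'\<in>large_boxes D K. \<bar>dual I \<theta> (\<psi> b) - dual I \<theta> (\<psi> b')\<bar> \<le> e'"
        unfolding \<psi>_def using dual_face_avg[OF D ID f(1) \<theta>(1)] by (simp add: case_prod_unfold)
    qed
    then show ?thesis using S by (auto simp: Ball_def)
  qed
qed

section \<open>Integer powers of commuting bijections\<close>

definition zpow :: "('a \<Rightarrow> 'a) \<Rightarrow> int \<Rightarrow> 'a \<Rightarrow> 'a" where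
  "zpow t k = (if k \<ge> 0 then t ^^ nat k else inv t ^^ nat (- k))"

lemma zpow_0 [simp]: "zpow t 0 x = x"
  by (simp add: zpow_def)

lemma zpow_Suc:
  assumes "bij t"
  shows "zpow t (k + 1) x = t (zpow t k x)"
proof (cases "k \<ge> 0")
  case True
  then have "nat (k + 1) = Suc (nat k)" by simp
  then show ?thesis using True by (simp add: zpow_def)
next
  case False
  then have "nat (- k) = Suc (nat (- (k + 1)))" by simp
  then have "zpow t k x = inv t ((inv t ^^ nat (- (k + 1))) x)" using False by (simp add: zpow_def)
  moreover have "t (inv t y) = y" for y by (rule surj_f_inv_f[OF bij_is_surj[OF assms]])
  ultimately show ?thesis using False by (auto simp: zpow_def)
qed

lemma zpow_add:
  assumes "bij t"
  shows "zpow t (k + l) x = zpow t k (zpow t l x)"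
proof (induction k rule: int_induct[of _ 0])
  case (step1 k)
  have "zpow t (k + 1 + l) x = zpow t ((k + l) + 1) x" by (simp add: algebra_simps)
  then show ?case using step1 by (simp only: zpow_Suc[OF assms])
next
  case (step2 k)
  have "t (zpow t (k - 1 + l) x) = zpow t ((k - 1 + l) + 1) x" by (rule zpow_Suc[OF assms, symmetric])
  also have "\<dots> = zpow t k (zpow t l x)" using step2 by (simp add: algebra_simps)
  also have "\<dots> = t (zpow t (k - 1) (zpow t l x))" using zpow_Suc[OF assms, of "k - 1"] by simp
  finally show ?case using bij_is_inj[OF assms] by (simp add: inj_eq)
qed simp

lemma zpow_commute1:
  assumes "bij t" "\<And>x. f (t x) = t (f x)"
  shows "f (zpow t k x) = zpow t k (f x)"
proof (induction k rule: int_induct[of _ 0])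
  case (step1 k)
  then show ?case by (simp add: zpow_Suc assms)
next
  case (step2 k)
  have "t (f (zpow t (k - 1) x)) = f (zpow t k x)"
    using zpow_Suc[OF assms(1), of "k - 1"] by (simp add: assms(2)[symmetric])
  also have "\<dots> = t (zpow t (k - 1) (f x))"
    using step2 zpow_Suc[OF assms(1), of "k - 1"] by simp
  finally show ?case using bij_is_inj[OF assms(1)] by (simp add: inj_eq)
qed simp

lemma zpow_commute:
  assumes "bij s" "bij t" "\<And>x. s (t x) = t (s x)"
  shows "zpow s k (zpow t l x) = zpow t l (zpow s k x)"
proof (rule zpow_commute1[OF assms(2)])
  fix x show "zpow s k (t x) = t (zpow s k x)"
    by (rule zpow_commute1[OF assms(1), symmetric]) (rule assms(3)[symmetric])
qed

section \<open>The system of commuting measure preserving transformations\<close>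

locale commuting_transformations = prob_space \<mu> for \<mu> :: "'a measure" +
  fixes d :: nat and T :: "nat \<Rightarrow> 'a \<Rightarrow> 'a"
  assumes mp: "\<And>i. i \<in> {1..d} \<Longrightarrow> invertible_measure_preserving \<mu> (T i)"
    and commute: "\<And>i j x. i \<in> {1..d} \<Longrightarrow> j \<in> {1..d} \<Longrightarrow> x \<in> space \<mu> \<Longrightarrow> T i (T j x) = T j (T i x)"
begin

text \<open>
  Extending by the identity outside the space makes the maps commuting bijections of the whole
  type, as the action in \<open>zsystem\<close> is by maps of the whole type.
\<close>

definition t :: "nat \<Rightarrow> 'a \<Rightarrow> 'a" where
  "t i x = (if x \<in> space \<mu> then T i x else x)"

lemma T_bij: "i \<in> {1..d} \<Longrightarrow> bij_betw (T i) (space \<mu>) (space \<mu>)"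
  using mp by (auto simp: invertible_measure_preserving_def)

lemma T_space: "i \<in> {1..d} \<Longrightarrow> x \<in> space \<mu> \<Longrightarrow> T i x \<in> space \<mu>"
  using T_bij bij_betwE by blast

lemma bij_t:
  assumes "i \<in> {1..d}" shows "bij (t i)"
proof -
  have "bij_betw (t i) (space \<mu>) (space \<mu>)"
    using T_bij[OF assms] by (rule bij_betw_cong[THEN iffD1, rotated]) (simp add: t_def)
  moreover have "bij_betw (t i) (- space \<mu>) (- space \<mu>)"
    by (rule bij_betw_cong[THEN iffD1, OF _ bij_betw_id]) (simp add: t_def)
  ultimately have "bij_betw (t i) (space \<mu> \<union> - space \<mu>) (space \<mu> \<union> - space \<mu>)"
    by (rule bij_betw_combine) auto
  then show ?thesis by (simp add: Compl_partition)
qed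

lemma t_commute: "i \<in> {1..d} \<Longrightarrow> j \<in> {1..d} \<Longrightarrow> t i (t j x) = t j (t i x)"
  using commute[of i j x] T_space[of i x] T_space[of j x] by (simp add: t_def)

lemma inv_t:
  assumes "i \<in> {1..d}" "x \<in> space \<mu>"
  shows "inv (t i) x = inv_into (space \<mu>) (T i) x"
proof (rule inv_f_eq[OF bij_is_inj[OF bij_t[OF assms(1)]]])
  let ?y = "inv_into (space \<mu>) (T i) x"
  have "T i ` space \<mu> = space \<mu>" using T_bij[OF assms(1)] by (rule bij_betw_imp_surj_on)
  then have "?y \<in> space \<mu>" "T i ?y = x"
    using assms(2) by (auto intro: inv_into_into f_inv_into_f)
  then show "t i ?y = x" by (simp add: t_def)
qed

definition preserving :: "('a \<Rightarrow> 'a) \<Rightarrow> bool" where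
  "preserving f \<longleftrightarrow> f \<in> measurable \<mu> \<mu> \<and> distr \<mu> \<mu> f = \<mu>"

lemma preserving_id: "preserving (\<lambda>x. x)"
  by (simp add: preserving_def distr_id2)

lemma preserving_comp: "preserving f \<Longrightarrow> preserving g \<Longrightarrow> preserving (\<lambda>x. f (g x))"
  unfolding preserving_def using distr_distr[of f \<mu> \<mu> g \<mu>] by (auto simp: comp_def)

lemma preserving_t:
  assumes i: "i \<in> {1..d}" shows "preserving (t i)"
proof -
  have m: "t i \<in> measurable \<mu> \<mu>"
    using mp[OF i] by (subst measurable_cong[of _ _ "T i"]) (auto simp: invertible_measure_preserving_def t_def)
  have "distr \<mu> \<mu> (t i) = \<mu>"
  proof (rule measure_eqI)
    fix B assume "B \<in> sets (distr \<mu> \<mu> (t i))"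
    then have B: "B \<in> sets \<mu>" by simp
    have "t i -` B \<inter> space \<mu> = T i -` B \<inter> space \<mu>" by (auto simp: t_def)
    then show "emeasure (distr \<mu> \<mu> (t i)) B = emeasure \<mu> B"
      using mp[OF i] B m by (simp add: emeasure_distr invertible_measure_preserving_def)
  qed simp
  then show ?thesis using m by (simp add: preserving_def)
qed

lemma preserving_inv_t:
  assumes i: "i \<in> {1..d}" shows "preserving (inv (t i))"
proof -
  have m: "inv (t i) \<in> measurable \<mu> \<mu>"
    using mp[OF i] inv_t[OF i]
    by (subst measurable_cong[of _ _ "inv_into (space \<mu>) (T i)"]) (auto simp: invertible_measure_preserving_def)
  have "distr (distr \<mu> \<mu> (t i)) \<mu> (inv (t i)) = distr \<mu> \<mu> (inv (t i) \<circ> t i)"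
    using m preserving_t[OF i] by (intro distr_distr) (auto simp: preserving_def)
  also have "inv (t i) \<circ> t i = id" using bij_t[OF i] by (simp add: bij_is_inj)
  finally show ?thesis using m preserving_t[OF i] by (simp add: preserving_def distr_id)
qed

lemma preserving_funpow: "preserving f \<Longrightarrow> preserving (f ^^ n)"
proof (induction n)
  case 0
  then show ?case using preserving_id by (simp add: id_def)
next
  case (Suc n)
  then show ?case using preserving_comp[of f "f ^^ n"] by (simp add: comp_def)
qed

lemma preserving_zpow: "i \<in> {1..d} \<Longrightarrow> preserving (zpow (t i) k)"
  using preserving_funpow[OF preserving_t] preserving_funpow[OF preserving_inv_t] by (simp add: zpow_def)

lemma preserving_space: "preserving f \<Longrightarrow> x \<in> space \<mu> \<Longrightarrow> f x \<in> space \<mu>"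
  unfolding preserving_def by (erule conjE, erule measurable_space)

lemma int_iterate_eq:
  assumes i: "i \<in> {1..d}" and x: "x \<in> space \<mu>"
  shows "int_iterate \<mu> (T i) k x = zpow (t i) k x"
proof -
  have "(T i ^^ n) x = (t i ^^ n) x \<and> (t i ^^ n) x \<in> space \<mu>" for n
  proof (induction n)
    case (Suc n)
    then show ?case using T_space[OF i] by (simp add: t_def)
  qed (simp add: x)
  moreover have "(inv_into (space \<mu>) (T i) ^^ n) x = (inv (t i) ^^ n) x" for n
  proof (induction n)
    case (Suc n)
    have "(inv (t i) ^^ n) x \<in> space \<mu>"
      by (rule preserving_space[OF preserving_funpow[OF preserving_inv_t[OF i]] x])
    then show ?case using Suc by (simp add: inv_t[OF i])
  qed simp
  ultimately show ?thesis by (simp add: int_iterate_def zpow_def)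
qed

definition acts :: "nat list \<Rightarrow> (nat \<Rightarrow> int) \<Rightarrow> 'a \<Rightarrow> 'a" where
  "acts is n = fold (\<lambda>i. zpow (t i) (n i)) is"

lemma acts_Nil [simp]: "acts [] n x = x" and acts_Cons [simp]: "acts (i # is) n x = acts is n (zpow (t i) (n i) x)"
  by (simp_all add: acts_def)

lemma zpow_t_commute:
  assumes "i \<in> {1..d}" "j \<in> {1..d}"
  shows "zpow (t i) k (zpow (t j) l x) = zpow (t j) l (zpow (t i) k x)"
  by (rule zpow_commute[OF bij_t[OF assms(1)] bij_t[OF assms(2)] t_commute[OF assms]])

lemma zpow_acts: "i \<in> {1..d} \<Longrightarrow> set is \<subseteq> {1..d} \<Longrightarrow> zpow (t i) k (acts is n x) = acts is n (zpow (t i) k x)"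
proof (induction "is" arbitrary: x)
  case (Cons j js)
  then show ?case using zpow_t_commute[of i j] by simp
qed simp

lemma acts_add: "set is \<subseteq> {1..d} \<Longrightarrow> acts is m (acts is n x) = acts is (\<lambda>i. m i + n i) x"
proof (induction "is" arbitrary: x)
  case (Cons j js)
  then show ?case by (simp add: zpow_acts zpow_add[OF bij_t])
qed simp

lemma acts_zero: "acts is (\<lambda>_. 0) x = x"
  by (induction "is") auto

lemma acts_cong: "(\<And>i. i \<in> set is \<Longrightarrow> m i = n i) \<Longrightarrow> acts is m x = acts is n x"
  by (induction "is" arbitrary: x) auto

lemma preserving_acts: "set is \<subseteq> {1..d} \<Longrightarrow> preserving (acts is n)"
proof (induction "is")
  case Nil
  then show ?case using preserving_id by (simp add: acts_def id_def)
next
  case (Cons i js)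
  then have "preserving (acts js n)" "preserving (zpow (t i) (n i))"
    using preserving_zpow by auto
  then have "preserving (\<lambda>x. acts js n (zpow (t i) (n i) x))"
    by (rule preserving_comp)
  moreover have "acts (i # js) n = (\<lambda>x. acts js n (zpow (t i) (n i) x))" by auto
  ultimately show ?case by simp
qed

text \<open>
  Images under negative powers are preimages under positive ones; the outermost image corresponds
  to the power that is applied first.
\<close>

lemma foldr_image_eq:
  assumes "set is \<subseteq> {1..d}" "A \<subseteq> space \<mu>"
  shows "foldr (\<lambda>i S. int_iterate \<mu> (T i) (- k i) ` S) is A = {x \<in> space \<mu>. acts is k x \<in> A}"
  using assms(1)
proof (induction "is")
  case Nil
  then show ?case using assms(2) by auto
next
  case (Cons i js)
  let ?S = "{x \<in> space \<mu>. acts js k x \<in> A}"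
  have i: "i \<in> {1..d}" using Cons by auto
  have sp: "zpow (t i) l x \<in> space \<mu>" if "x \<in> space \<mu>" for l x
    by (rule preserving_space[OF preserving_zpow[OF i] that])
  have inv: "zpow (t i) (- l) (zpow (t i) l x) = x" "zpow (t i) l (zpow (t i) (- l) x) = x" for l x
    by (simp_all add: zpow_add[OF bij_t[OF i], symmetric])
  have "int_iterate \<mu> (T i) (- k i) ` ?S = zpow (t i) (- k i) ` ?S"
    by (intro image_cong refl int_iterate_eq[OF i]) auto
  also have "\<dots> = {x \<in> space \<mu>. acts js k (zpow (t i) (k i) x) \<in> A}"
  proof (intro equalityI subsetI)
    fix x assume x: "x \<in> {x \<in> space \<mu>. acts js k (zpow (t i) (k i) x) \<in> A}"
    then have "x = zpow (t i) (- k i) (zpow (t i) (k i) x)" by (simp add: inv)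
    moreover have "zpow (t i) (k i) x \<in> ?S" using x sp by auto
    ultimately show "x \<in> zpow (t i) (- k i) ` ?S" by (rule image_eqI)
  qed (auto simp: sp inv)
  finally show ?case using Cons by simp
qed

text \<open>
  The probability space is embedded at a constant stream; this determines the mean, and the
  stream is not moved until extensions are formed.
\<close>

definition obs :: "('a tower \<Rightarrow> real) set" where
  "obs = {F. (\<exists>C. \<forall>c. \<bar>F c\<bar> \<le> C) \<and> (\<lambda>x. F (x, sconst (\<lambda>_. 0))) \<in> borel_measurable \<mu>}"

definition mean :: "('a tower \<Rightarrow> real) \<Rightarrow> real" where
  "mean F = (\<integral>x. F (x, sconst (\<lambda>_. 0)) \<partial>\<mu>)"

definition tower_act :: "(nat \<Rightarrow> int) \<Rightarrow> 'a tower \<Rightarrow> 'a tower" where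
  "tower_act n c = (acts [1..<Suc d] n (fst c), snd c)"

lemma obs_integrable:
  assumes "F \<in> obs"
  shows "integrable \<mu> (\<lambda>x. F (x, sconst (\<lambda>_. 0)))"
proof -
  obtain C where "\<And>c. \<bar>F c\<bar> \<le> C" using assms by (auto simp: obs_def)
  then show ?thesis
    using assms by (intro integrable_const_bound[where B = C]) (auto simp: obs_def)
qed

lemma tower_system_obs: "tower_system obs mean tower_act"
proof
  let ?s = "sconst (\<lambda>_. 0) :: (nat \<Rightarrow> int) stream"
  fix c show "(\<lambda>_. c) \<in> obs" by (auto simp: obs_def)
next
  fix F G assume FG: "F \<in> obs" "G \<in> obs"
  obtain C where C: "\<And>c. \<bar>F c\<bar> \<le> C" using FG by (auto simp: obs_def)
  obtain C' where C': "\<And>c. \<bar>G c\<bar> \<le> C'" using FG by (auto simp: obs_def)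
  have "\<bar>F c + G c\<bar> \<le> C + C'" for c
    by (rule order_trans[OF abs_triangle_ineq add_mono[OF C C']])
  then have "\<exists>C. \<forall>c. \<bar>F c + G c\<bar> \<le> C" by blast
  then show "(\<lambda>x. F x + G x) \<in> obs" using FG by (auto simp: obs_def simp del: split_paired_All split_paired_Ex)
  have "\<bar>F c * G c\<bar> \<le> C * C'" for c
    unfolding abs_mult by (intro mult_mono C C') (use C[of c] in auto)
  then have "\<exists>C. \<forall>c. \<bar>F c * G c\<bar> \<le> C" by blast
  then show "(\<lambda>x. F x * G x) \<in> obs" using FG by (auto simp: obs_def simp del: split_paired_All split_paired_Ex)
  show "mean (\<lambda>x. F x + G x) = mean F + mean G"
    unfolding mean_def by (intro Bochner_Integration.integral_add obs_integrable FG)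
next
  fix F and n :: "nat \<Rightarrow> int" assume F: "F \<in> obs"
  then show "\<exists>C. \<forall>x. \<bar>F x\<bar> \<le> C" by (simp add: obs_def)
  have p: "preserving (acts [1..<Suc d] n)" by (rule preserving_acts) auto
  then have m: "acts [1..<Suc d] n \<in> measurable \<mu> \<mu>" and D: "distr \<mu> \<mu> (acts [1..<Suc d] n) = \<mu>"
    by (auto simp: preserving_def)
  have Fm: "(\<lambda>x. F (x, sconst (\<lambda>_. 0))) \<in> borel_measurable \<mu>" using F by (simp add: obs_def)
  obtain C where "\<And>c. \<bar>F c\<bar> \<le> C" using F by (auto simp: obs_def)
  then have "\<forall>c. \<bar>F (tower_act n c)\<bar> \<le> C" by blast
  moreover have "(\<lambda>x. F (tower_act n (x, sconst (\<lambda>_. 0)))) \<in> borel_measurable \<mu>"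
    unfolding tower_act_def fst_conv snd_conv by (rule measurable_compose[OF m Fm])
  ultimately show "(\<lambda>x. F (tower_act n x)) \<in> obs" unfolding obs_def by blast
  show "mean (\<lambda>x. F (tower_act n x)) = mean F"
    unfolding mean_def tower_act_def fst_conv snd_conv
    using integral_distr[OF m Fm] unfolding D by simp
next
  fix F :: "'a tower \<Rightarrow> real" assume "F \<in> obs" "\<And>x. 0 \<le> F x"
  then show "0 \<le> mean F" by (simp add: mean_def)
next
  fix m n x
  show "tower_act m (tower_act n x) = tower_act (\<lambda>i. m i + n i) x"
  proof -
    have "set [1..<Suc d] \<subseteq> {1..d}" by auto
    then show ?thesis by (simp add: tower_act_def acts_add del: upt_Suc)
  qed
qed (auto simp: mean_def tower_act_def acts_zero prob_space)

lemma cube_avg_indicator: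
  assumes A: "A \<in> sets \<mu>" and MN: "\<And>i. i \<in> {1..d} \<Longrightarrow> M i < N i"
  shows "zsystem.cube_avg mean tower_act {1..d} (\<lambda>_ c. indicator A (fst c)) M N = cube_average \<mu> d T A M N"
proof -
  interpret S: tower_system obs mean tower_act by (rule tower_system_obs)
  let ?l = "[1..<Suc d]" and ?D = "{1..d}"
  have AS: "A \<subseteq> space \<mu>" using A by (rule sets.sets_into_space)
  have l: "set ?l \<subseteq> ?D" by auto
  have inter: "(\<Inter>\<epsilon>\<in>cube d. translate \<mu> d T (\<lambda>i. - (n i * \<epsilon> i)) A)
      = {x \<in> space \<mu>. \<forall>J\<in>Pow ?D. acts ?l (mask J n) x \<in> A}" for n
  proof -
    have tr: "translate \<mu> d T (\<lambda>i. - (n i * \<epsilon> i)) A = {x \<in> space \<mu>. acts ?l (\<lambda>i. n i * \<epsilon> i) x \<in> A}" for \<epsilon>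
      unfolding translate_def by (rule foldr_image_eq[OF l AS])
    have to_set: "\<exists>J\<in>Pow ?D. \<forall>x. acts ?l (\<lambda>i. n i * \<epsilon> i) x = acts ?l (mask J n) x" if "\<epsilon> \<in> cube d" for \<epsilon>
    proof (intro bexI[of _ "{i\<in>?D. \<epsilon> i = 1}"] allI acts_cong)
      fix i assume "i \<in> set ?l"
      then have "i \<in> ?D" by auto
      then have "\<epsilon> i = 0 \<or> \<epsilon> i = 1" using that by (auto simp: cube_def PiE_def Pi_def)
      then show "n i * \<epsilon> i = mask {i \<in> ?D. \<epsilon> i = 1} n i" using \<open>i \<in> ?D\<close> by (auto simp: mask_def)
    qed auto
    have to_cube: "\<exists>\<epsilon>\<in>cube d. \<forall>x. acts ?l (\<lambda>i. n i * \<epsilon> i) x = acts ?l (mask J n) x" if "J \<in> Pow ?D" for J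
    proof (intro bexI[of _ "\<lambda>i\<in>?D. if i \<in> J then 1 else 0"] allI acts_cong)
      fix i assume "i \<in> set ?l"
      then have "i \<in> ?D" by auto
      then show "n i * (\<lambda>i\<in>?D. if i \<in> J then 1 else 0) i = mask J n i" by (auto simp: mask_def)
    qed (auto simp: cube_def)
    show ?thesis
      unfolding tr
    proof (intro equalityI subsetI INT_I CollectI conjI ballI)
      fix x assume x: "x \<in> (\<Inter>\<epsilon>\<in>cube d. {x \<in> space \<mu>. acts ?l (\<lambda>i. n i * \<epsilon> i) x \<in> A})"
      have "(\<lambda>i\<in>?D. 0) \<in> cube d" by (auto simp: cube_def)
      then show "x \<in> space \<mu>" using x by blast
      fix J assume "J \<in> Pow ?D"
      then obtain \<epsilon> where "\<epsilon> \<in> cube d" "acts ?l (\<lambda>i. n i * \<epsilon> i) x = acts ?l (mask J n) x"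
        using to_cube by metis
      then show "acts ?l (mask J n) x \<in> A" using x by force
    next
      fix x \<epsilon> assume x: "x \<in> {x \<in> space \<mu>. \<forall>J\<in>Pow ?D. acts ?l (mask J n) x \<in> A}" and "\<epsilon> \<in> cube d"
      then obtain J where "J \<in> Pow ?D" "acts ?l (\<lambda>i. n i * \<epsilon> i) x = acts ?l (mask J n) x"
        using to_set by metis
      then show "acts ?l (\<lambda>i. n i * \<epsilon> i) x \<in> A" using x by simp
      show "x \<in> space \<mu>" using x by simp
    qed
  qed
  have vertex_measure: "mean (\<lambda>c. \<Prod>J\<in>Pow ?D. indicator A (fst (tower_act (mask J n) c)))
      = measure \<mu> (\<Inter>\<epsilon>\<in>cube d. translate \<mu> d T (\<lambda>i. - (n i * \<epsilon> i)) A)" for n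
  proof -
    let ?B = "{x \<in> space \<mu>. \<forall>J\<in>Pow ?D. acts ?l (mask J n) x \<in> A}"
    have "(\<Prod>J\<in>Pow ?D. indicator A (acts ?l (mask J n) x) :: real) = indicator ?B x" if "x \<in> space \<mu>" for x
    proof (cases "\<forall>J\<in>Pow ?D. acts ?l (mask J n) x \<in> A")
      case True
      then show ?thesis using that by (simp add: indicator_def)
    next
      case False
      then show ?thesis by (auto simp: indicator_def simp del: upt_Suc intro!: prod_zero)
    qed
    then have "mean (\<lambda>c. \<Prod>J\<in>Pow ?D. indicator A (fst (tower_act (mask J n) c))) = (\<integral>x. indicator ?B x \<partial>\<mu>)"
      unfolding mean_def tower_act_def fst_conv by (intro Bochner_Integration.integral_cong refl)
    also have "\<dots> = measure \<mu> (?B \<inter> space \<mu>)" by simp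
    also have "?B \<inter> space \<mu> = ?B" by auto
    finally show ?thesis unfolding inter .
  qed
  have "real (card (grid ?D M N)) = (\<Prod>i=1..d. real_of_int (N i - M i))"
    unfolding grid_def using MN by (auto simp: card_PiE less_imp_le intro!: prod.cong)
  then show ?thesis
    unfolding S.cube_avg_def vertex_measure cube_average_def avg_def grid_def
    by (simp add: prod_dividef)
qed

end

theorem theorem1p2:
  fixes \<mu> :: "'a measure" and d :: nat and T :: "nat \<Rightarrow> 'a \<Rightarrow> 'a" and A :: "'a set"
    and M N :: "nat \<Rightarrow> nat \<Rightarrow> int"
  assumes "d \<ge> 1"
    and "prob_space \<mu>"
    and "\<And>i. i \<in> {1..d} \<Longrightarrow> invertible_measure_preserving \<mu> (T i)"
    and "\<And>i j x. i \<in> {1..d} \<Longrightarrow> j \<in> {1..d} \<Longrightarrow> x \<in> space \<mu> \<Longrightarrow> T i (T j x) = T j (T i x)"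
    and "A \<in> sets \<mu>"
    and "\<And>i k. i \<in> {1..d} \<Longrightarrow> M i k < N i k"
    and "\<And>i. i \<in> {1..d} \<Longrightarrow> filterlim (\<lambda>k. N i k - M i k) at_top sequentially"
  shows "\<exists>L. (\<lambda>k. cube_average \<mu> d T A (\<lambda>i. M i k) (\<lambda>i. N i k)) \<longlonglongrightarrow> L \<and>
             L \<ge> measure \<mu> A ^ (2 ^ d)"
proof -
  interpret prob_space \<mu> by (rule assms(2))
  interpret commuting_transformations \<mu> d T by unfold_locales (use assms in auto)
  interpret S: tower_system obs mean tower_act by (rule tower_system_obs)
  let ?D = "{1..d}"
  define u :: "'a tower \<Rightarrow> real" where "u = (\<lambda>c. indicator A (fst c))"
  define a where "a = (\<lambda>k. cube_average \<mu> d T A (\<lambda>i. M i k) (\<lambda>i. N i k))"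
  have u: "u \<in> obs" "\<And>c. \<bar>u c\<bar> \<le> 1"
    using assms(5) by (auto simp: u_def obs_def indicator_def intro!: exI[of _ 1])
  have Eu: "mean u = measure \<mu> A"
    using sets.sets_into_space[OF assms(5)] by (simp add: mean_def u_def Int_absorb2)
  have a: "a k = S.cube_avg ?D (\<lambda>_. u) (\<lambda>i. M i k) (\<lambda>i. N i k)" for k
    unfolding a_def u_def using assms(5,6) by (intro cube_avg_indicator[symmetric]) auto
  have Cauchy: "\<exists>K. \<forall>(M, N)\<in>large_boxes ?D K. \<forall>(M', N')\<in>large_boxes ?D K.
      \<bar>S.cube_avg ?D (\<lambda>_. u) M N - S.cube_avg ?D (\<lambda>_. u) M' N'\<bar> \<le> e" if "0 < e" for e
    by (rule cube_avg_Cauchy[OF tower_system_obs, of _ "Pow ?D"]) (use u that in auto)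
  have large: "eventually (\<lambda>k. ((\<lambda>i. M i k), (\<lambda>i. N i k)) \<in> large_boxes ?D K) sequentially" for K
  proof -
    have "eventually (\<lambda>k. \<forall>i\<in>?D. int K \<le> N i k - M i k) sequentially"
      using assms(7) by (intro eventually_ball_finite) (auto simp: filterlim_at_top)
    then show ?thesis by eventually_elim (use assms(6) in \<open>auto simp: large_boxes_def\<close>)
  qed
  have "Cauchy a"
  proof (rule metric_CauchyI)
    fix e :: real assume "0 < e"
    then obtain K where K: "\<forall>(M, N)\<in>large_boxes ?D K. \<forall>(M', N')\<in>large_boxes ?D K.
        \<bar>S.cube_avg ?D (\<lambda>_. u) M N - S.cube_avg ?D (\<lambda>_. u) M' N'\<bar> \<le> e / 2"
      using Cauchy[of "e / 2"] by auto
    obtain k0 where "\<And>k. k0 \<le> k \<Longrightarrow> ((\<lambda>i. M i k), (\<lambda>i. N i k)) \<in> large_boxes ?D K"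
      using large[of K] by (auto simp: eventually_sequentially)
    then have "\<bar>a m - a n\<bar> \<le> e / 2" if "k0 \<le> m" "k0 \<le> n" for m n
      unfolding a using K that by fast
    then show "\<exists>k0. \<forall>m\<ge>k0. \<forall>n\<ge>k0. dist (a m) (a n) < e"
      using \<open>0 < e\<close> by (intro exI[of _ k0]) (force simp: dist_real_def)
  qed
  then obtain L where L: "a \<longlonglongrightarrow> L" using Cauchy_convergent convergent_def by blast
  have "measure \<mu> A ^ (2 ^ d) \<le> L + e" if e: "0 < e" for e
  proof -
    obtain K where K: "\<forall>(M, N)\<in>large_boxes ?D K. \<forall>(M', N')\<in>large_boxes ?D K.
        \<bar>S.cube_avg ?D (\<lambda>_. u) M N - S.cube_avg ?D (\<lambda>_. u) M' N'\<bar> \<le> e"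
      using Cauchy[OF e] by auto
    obtain M' N' where MN': "\<And>i. N' i - M' i = int (Suc K)"
      and le: "S.box_mean ?D (Suc K) u \<le> S.cube_avg ?D (\<lambda>_. u) M' N'"
      using S.box_mean_le_cube_avg[of ?D "Suc K" u] by blast
    have big: "(M', N') \<in> large_boxes ?D K"
      using MN' by (auto simp: large_boxes_def) (smt (verit) of_nat_0_le_iff)
    have near: "eventually (\<lambda>k. S.cube_avg ?D (\<lambda>_. u) M' N' - e \<le> a k) sequentially"
      using large[of K]
    proof eventually_elim
      case (elim k)
      then have "\<bar>S.cube_avg ?D (\<lambda>_. u) M' N' - a k\<bar> \<le> e" unfolding a using K big by fast
      then show ?case by linarith
    qed
    have "measure \<mu> A ^ (2 ^ d) \<le> S.box_mean ?D (Suc K) u"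
      using S.box_mean_ge[of ?D u "Suc K"] u by (simp add: Eu)
    also have "\<dots> \<le> L + e"
      using le tendsto_lowerbound[OF L near] by simp
    finally show ?thesis .
  qed
  then have "measure \<mu> A ^ (2 ^ d) \<le> L" by (rule field_le_epsilon)
  then show ?thesis using L unfolding a_def by blast
qed

end
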